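(* Consider a 3-user CGZIC $Y_1=X_1+Z_1$, $Y_2=X_2+a_1X_1+Z_2$, $Y_3=X_3+a_2X_2+Z_3$ with gains $a_1,a_2\ge 0$ and power constraints $P_1,P_2,P_3$, and suppose $1\le a_1<\sqrt{1+P_2}$ and $a_2\le \sqrt{\frac{1}{1+a_1^2P_1}}$. Then the sum capacity satisfies \[ C_{\mathrm{sum}}\le \mathcal{C}(a_1^2P_1+P_2)+\mathcal{C}\!\left(\frac{P_3}{1+a_2^2P_2}\right)+0.5. \]
   Context: The noises $Z_i\sim\mathcal N(0,1)$ are i.i.d. (independent across users and time), the channel is memoryless and real, user $i$ has average power constraint $P_i>0$, each receiver $i$ decodes only its own message from $Y_i^n$, and achievability is defined in the standard way. The sum capacity is the supremum of $R_1+R_2+R_3$ over the capacity region. $\mathcal{C}(x)=\tfrac12\log_2(1+x)$; logarithms are base 2. *)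

theory Defs
  imports "HOL-Probability.Probability"
begin

text \<open>Users 1,2,3 are indexed 0,1,2. Time indices are 0..n-1.\<close>

definition Cfun :: "real \<Rightarrow> real" where
  "Cfun x = 1/2 * log 2 (1 + x)"

definition noise_measure :: "nat \<Rightarrow> (nat \<times> nat \<Rightarrow> real) measure" where
  "noise_measure n = PiM ({..<3} \<times> {..<n}) (\<lambda>_. density lborel std_normal_density)"

definition rx :: "real \<Rightarrow> real \<Rightarrow> nat \<Rightarrow> (nat \<Rightarrow> nat \<Rightarrow> nat \<Rightarrow> real) \<Rightarrow> (nat \<Rightarrow> nat)
                  \<Rightarrow> (nat \<times> nat \<Rightarrow> real) \<Rightarrow> nat \<Rightarrow> (nat \<Rightarrow> real)" where
  "rx a1 a2 n x m z i = restrict (\<lambda>t.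
      (if i = 0 then x 0 (m 0) t + z (0, t)
       else if i = 1 then x 1 (m 1) t + a1 * x 0 (m 0) t + z (1, t)
       else x 2 (m 2) t + a2 * x 1 (m 1) t + z (2, t))) {..<n}"

text \<open>Average (uniform messages) probability that some receiver decodes wrongly.
  Code: M i messages for user i, encoder x i : message \<Rightarrow> time \<Rightarrow> real, decoder d i.\<close>
definition err_prob :: "real \<Rightarrow> real \<Rightarrow> nat \<Rightarrow> (nat \<Rightarrow> nat) \<Rightarrow> (nat \<Rightarrow> nat \<Rightarrow> nat \<Rightarrow> real)
                        \<Rightarrow> (nat \<Rightarrow> (nat \<Rightarrow> real) \<Rightarrow> nat) \<Rightarrow> real" where
  "err_prob a1 a2 n M x d =
     (\<Sum>m\<in>{m. \<forall>i<3. m i < M i} \<inter> {m. \<forall>i\<ge>3. m i = 0}.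
        measure (noise_measure n)
          {z \<in> space (noise_measure n). \<exists>i<3. d i (rx a1 a2 n x m z i) \<noteq> m i})
     / (real (M 0) * real (M 1) * real (M 2))"

definition is_code :: "real \<Rightarrow> real \<Rightarrow> real \<Rightarrow> nat \<Rightarrow> (nat \<Rightarrow> nat) \<Rightarrow> (nat \<Rightarrow> nat \<Rightarrow> nat \<Rightarrow> real)
                        \<Rightarrow> (nat \<Rightarrow> (nat \<Rightarrow> real) \<Rightarrow> nat) \<Rightarrow> bool" where
  "is_code P1 P2 P3 n M x d \<longleftrightarrow>
     (\<forall>i<3. M i \<ge> 1) \<and>
     (\<forall>i<3. \<forall>m<M i. (\<Sum>t<n. (x i m t)\<^sup>2) \<le> real n * [P1, P2, P3] ! i) \<and>
     (\<forall>i<3. d i \<in> PiM {..<n} (\<lambda>_. borel) \<rightarrow>\<^sub>M count_space (UNIV :: nat set))"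

definition achievable :: "real \<Rightarrow> real \<Rightarrow> real \<Rightarrow> real \<Rightarrow> real \<Rightarrow> real \<times> real \<times> real \<Rightarrow> bool" where
  "achievable a1 a2 P1 P2 P3 R \<longleftrightarrow>
     (let Rs = [fst R, fst (snd R), snd (snd R)] in
     (\<forall>i<3. Rs ! i \<ge> 0) \<and>
     (\<forall>\<epsilon>>0. \<exists>N. \<forall>n\<ge>N. n \<ge> 1 \<and> (\<exists>M x d. is_code P1 P2 P3 n M x d \<and>
         (\<forall>i<3. real (M i) \<ge> 2 powr (real n * Rs ! i)) \<and>
         err_prob a1 a2 n M x d \<le> \<epsilon>)))"

text \<open>Sum capacity: supremum of R1+R2+R3 over the capacity region (closure of the achievable
  set; the closure does not change the supremum). Taken in ereal so it is meaningful even a priori.\<close>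
definition sum_capacity :: "real \<Rightarrow> real \<Rightarrow> real \<Rightarrow> real \<Rightarrow> real \<Rightarrow> ereal" where
  "sum_capacity a1 a2 P1 P2 P3 =
     (SUP R\<in>{R. achievable a1 a2 P1 P2 P3 R}. ereal (fst R + fst (snd R) + snd (snd R)))"

end

theory Submission
  imports Defs
begin

text \<open>
  Write \<open>V = a1 X1 + X2 + Z2\<close> for the output of receiver 2, \<open>U = a2 X2 + Z3\<close> for the interference
  plus noise at receiver 3, and \<open>S = a2 V + Z3\<close>.  As \<open>a1 \<ge> 1\<close>, receiver 2 can decode message 2,
  subtract \<open>X2\<close>, and add noise to obtain a copy of the output of receiver 1; hence Fano's inequality gives
  \<open>n (R1 + R2) \<le> h(V) - h(Z2)\<close> and \<open>n R3 \<le> h(Y3) - h(U)\<close>.  Linear estimation of \<open>V\<close> from \<open>S\<close> bounds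
  \<open>h(V) + h(Z3) - h(S)\<close>, and data processing bounds \<open>h(S) - h(U)\<close> by \<open>h(a2 (a1 X1 + Z2) + Z3) - h(Z3)\<close>;
  both bounds are Gaussian, and adding them costs at most half a bit per channel use because
  \<open>a2^2 (1 + a1^2 P1) \<le> 1\<close>.

  No differential entropy is needed.  Each of the four inequalities has the form \<open>E (ln e) \<le> 0\<close> for
  a density ratio \<open>e\<close> with \<open>E e \<le> 1\<close>.  The densities of \<open>V\<close>, \<open>S\<close> and \<open>U\<close> cancel in the product of the
  four ratios, so \<open>ln e \<le> e - 1\<close> is summed before integrating and only logarithms of Gaussian
  densities and of decoding weights have to be integrable.
\<close>

section \<open>Gaussian vectors\<close>

text \<open>The obstacle is the difference h(V) - h(U): power constraints bound entropies only from
  above, and U enters with a minus sign, so V and U cannot be treated separately. S is the bridge.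
  It uses the very noise Z3 that occurs in U, so it is at once a noisy multiple of V and the sum of
  U and a2 (a1 X1 + Z2). The difference splits into h(V) - h(S) and h(S) - h(U), and each part has
  an upper bound attained by Gaussian inputs of full power.

  The Gaussian references in the density ratios have free centres and variances; every choice gives
  a valid inequality. The variances are those of Gaussian inputs of full power. The centres come
  from the codebook means: a power constraint does not force a codebook to have mean zero, and
  without centring the cross terms between X1 and X2 would survive the average over messages.

  Only sums over messages and integrals over two independent noise vectors occur: \<open>z\<close>
  plays Z2 and \<open>w\<close> plays Z3. The noise Z1 is replaced by a combination of Z2 and fresh
  noise.\<close>

abbreviation std_normal :: "real measure" where
  "std_normal \<equiv> density lborel std_normal_density"

definition lebesgue_vec :: "nat \<Rightarrow> (nat \<Rightarrow> real) measure" where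
  "lebesgue_vec n = PiM {..<n} (\<lambda>_. lborel)"

definition gauss_vec :: "nat \<Rightarrow> (nat \<Rightarrow> real) measure" where
  "gauss_vec n = PiM {..<n} (\<lambda>_. std_normal)"

definition gauss_pdf :: "real \<Rightarrow> nat \<Rightarrow> (nat \<Rightarrow> real) \<Rightarrow> real" where
  "gauss_pdf v n y = (\<Prod>t<n. normal_density 0 (sqrt v) (y t))"

text \<open>Restricted because the values must lie in the space of \<open>PiM {..<n}\<close>.
  Arguments of \<open>gauss_pdf\<close> need no such care, since it reads only the coordinates below
  \<open>n\<close>.\<close>

definition vec_shift :: "nat \<Rightarrow> (nat \<Rightarrow> real) \<Rightarrow> (nat \<Rightarrow> real) \<Rightarrow> (nat \<Rightarrow> real)" where
  "vec_shift n c z = (\<lambda>t\<in>{..<n}. c t + z t)"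

lemma prob_space_std_normal: "prob_space std_normal"
  by (rule prob_space_normal_density) simp

lemma product_sigma_finite_lborel: "product_sigma_finite (\<lambda>_::nat. lborel :: real measure)"
  by standard

lemma product_prob_space_std_normal: "product_prob_space (\<lambda>_::nat. std_normal)"
proof -
  interpret prob_space std_normal by (rule prob_space_std_normal)
  show ?thesis by standard
qed

lemma product_sigma_finite_std_normal: "product_sigma_finite (\<lambda>_::nat. std_normal)"
  using product_prob_space_std_normal by (rule product_prob_space.axioms)

lemma sigma_finite_lebesgue_vec: "sigma_finite_measure (lebesgue_vec n)"
  unfolding lebesgue_vec_def
  by (rule product_sigma_finite.sigma_finite[OF product_sigma_finite_lborel]) simp

lemma prob_space_gauss_vec: "prob_space (gauss_vec n)"
  unfolding gauss_vec_def by (intro prob_space_PiM prob_space_std_normal)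

lemma sets_lebesgue_vec [measurable_cong]: "sets (lebesgue_vec n) = sets (PiM {..<n} (\<lambda>_. borel))"
  unfolding lebesgue_vec_def by (intro sets_PiM_cong) auto

lemma sets_gauss_vec [measurable_cong]: "sets (gauss_vec n) = sets (PiM {..<n} (\<lambda>_. borel))"
  unfolding gauss_vec_def by (intro sets_PiM_cong) auto

lemma measurable_gauss_vec_component: "t < n \<Longrightarrow> (\<lambda>z. z t) \<in> borel_measurable (gauss_vec n)"
  by (simp add: measurable_cong_sets[OF sets_gauss_vec refl] measurable_component_singleton)

lemma gauss_pdf_cong: "(\<And>t. t < n \<Longrightarrow> y t = y' t) \<Longrightarrow> gauss_pdf v n y = gauss_pdf v n y'"
  unfolding gauss_pdf_def by (intro prod.cong) auto

lemma gauss_pdf_pos: "v > 0 \<Longrightarrow> gauss_pdf v n y > 0"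
  unfolding gauss_pdf_def by (intro prod_pos) (auto intro!: normal_density_pos)

lemma gauss_pdf_nonneg: "gauss_pdf v n y \<ge> 0"
  unfolding gauss_pdf_def by (intro prod_nonneg) auto

text \<open>The one-dimensional density peaks at 1 / sqrt (2 pi) < 1. The bound passes to the
  mixture \<open>pdfU\<close> and so makes the Bochner integral that defines \<open>pdfS\<close>
  exist.\<close>

lemma gauss_pdf_le: "gauss_pdf 1 n y \<le> 1"
  unfolding gauss_pdf_def
proof (intro prod_le_1 conjI)
  fix t
  have "sqrt (2 * pi) \<ge> 1"
    using pi_gt3 by simp
  moreover have "exp (- (y t)\<^sup>2 / 2) \<le> 1" by simp
  ultimately have "exp (- (y t)\<^sup>2 / 2) \<le> sqrt (2 * pi)" by linarith
  then show "normal_density 0 (sqrt 1) (y t) \<le> 1"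
    using pi_gt3 by (simp add: std_normal_density_def divide_simps)
qed simp

lemma measurable_gauss_pdf [measurable (raw)]:
  assumes "\<And>t. t < n \<Longrightarrow> (\<lambda>w. y w t) \<in> borel_measurable M"
  shows "(\<lambda>w. gauss_pdf v n (y w)) \<in> borel_measurable M"
  unfolding gauss_pdf_def using assms by (intro borel_measurable_prod) (auto intro: measurable_compose)

lemma measurable_vec_shift [measurable (raw)]:
  assumes "\<And>t. t < n \<Longrightarrow> (\<lambda>w. c w t) \<in> borel_measurable M"
    and "\<And>t. t < n \<Longrightarrow> (\<lambda>w. z w t) \<in> borel_measurable M"
  shows "(\<lambda>w. vec_shift n (c w) (z w)) \<in> measurable M (PiM {..<n} (\<lambda>_. borel))"
  unfolding vec_shift_def using assms by (intro measurable_restrict) auto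

lemma ln_gauss_pdf:
  assumes "v > 0"
  shows "ln (gauss_pdf v n y) = - (real n / 2) * ln (2 * pi * v) - (\<Sum>t<n. (y t)\<^sup>2) / (2 * v)"
proof -
  have *: "ln (normal_density 0 (sqrt v) x) = - (1 / 2) * ln (2 * pi * v) - x\<^sup>2 / (2 * v)" for x
    using assms by (simp add: normal_density_def ln_mult ln_div ln_sqrt)
  have "ln (gauss_pdf v n y) = (\<Sum>t<n. ln (normal_density 0 (sqrt v) (y t)))"
    unfolding gauss_pdf_def using assms
    by (intro ln_prod) (auto simp: normal_density_pos less_imp_neq[symmetric])
  then show ?thesis
    by (simp add: * sum_subtractf sum_divide_distrib)
qed

lemma distr_vec_shift:
  "distr (lebesgue_vec n) (lebesgue_vec n) (vec_shift n c) = lebesgue_vec n"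
proof -
  interpret product_sigma_finite "\<lambda>_::nat. lborel :: real measure" by (rule product_sigma_finite_lborel)
  have "vec_shift n c \<in> measurable (lebesgue_vec n) (lebesgue_vec n)"
    by measurable
  note sh = this[unfolded lebesgue_vec_def]
  have "lebesgue_vec n = distr (lebesgue_vec n) (lebesgue_vec n) (vec_shift n c)"
    unfolding lebesgue_vec_def
  proof (rule PiM_eqI[symmetric])
    fix A :: "nat \<Rightarrow> real set" assume A: "\<And>i. i \<in> {..<n} \<Longrightarrow> A i \<in> sets lborel"
    then have B: "(\<lambda>x. c i + x) -` A i \<in> sets borel" if "i < n" for i
      using that measurable_sets[of "(\<lambda>x. c i + x)" borel borel "A i"] by auto
    have "emeasure (distr (PiM {..<n} (\<lambda>_. lborel)) (PiM {..<n} (\<lambda>_. lborel)) (vec_shift n c)) (Pi\<^sub>E {..<n} A)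
      = emeasure (PiM {..<n} (\<lambda>_. lborel)) (vec_shift n c -` Pi\<^sub>E {..<n} A \<inter> space (PiM {..<n} (\<lambda>_. lborel)))"
      using A by (intro emeasure_distr sh sets_PiM_I_finite) auto
    also have "vec_shift n c -` Pi\<^sub>E {..<n} A \<inter> space (PiM {..<n} (\<lambda>_. lborel)) = Pi\<^sub>E {..<n} (\<lambda>i. (\<lambda>x. c i + x) -` A i)"
      by (auto simp: vec_shift_def space_PiM PiE_iff)
    also have "emeasure (PiM {..<n} (\<lambda>_. lborel)) \<dots> = (\<Prod>i<n. emeasure lborel ((\<lambda>x. c i + x) -` A i))"
      using B by (intro emeasure_PiM) auto
    also have "\<dots> = (\<Prod>i<n. emeasure lborel (A i))"
    proof (intro prod.cong refl)
      fix i assume i: "i \<in> {..<n}"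
      have "emeasure lborel (A i) = emeasure (distr lborel borel (\<lambda>x. c i + x)) (A i)"
        by (simp add: lborel_distr_plus)
      also have "\<dots> = emeasure lborel ((\<lambda>x. c i + x) -` A i)"
        using A i by (subst emeasure_distr) auto
      finally show "emeasure lborel ((\<lambda>x. c i + x) -` A i) = emeasure lborel (A i)" ..
    qed
    finally show "emeasure (distr (PiM {..<n} (\<lambda>_. lborel)) (PiM {..<n} (\<lambda>_. lborel)) (vec_shift n c)) (Pi\<^sub>E {..<n} A)
      = (\<Prod>i\<in>{..<n}. emeasure lborel (A i))" .
  qed auto
  then show ?thesis by simp
qed

lemma nn_integral_vec_shift:
  assumes [measurable]: "F \<in> borel_measurable (PiM {..<n} (\<lambda>_. borel))"
  shows "(\<integral>\<^sup>+z. F (vec_shift n c z) \<partial>lebesgue_vec n) = (\<integral>\<^sup>+y. F y \<partial>lebesgue_vec n)"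
proof -
  have "(\<integral>\<^sup>+y. F y \<partial>lebesgue_vec n) = (\<integral>\<^sup>+y. F y \<partial>distr (lebesgue_vec n) (lebesgue_vec n) (vec_shift n c))"
    by (simp add: distr_vec_shift)
  also have "\<dots> = (\<integral>\<^sup>+z. F (vec_shift n c z) \<partial>lebesgue_vec n)"
    by (rule nn_integral_distr) measurable
  finally show ?thesis ..
qed

lemma gauss_vec_eq_density: "gauss_vec n = density (lebesgue_vec n) (gauss_pdf 1 n)"
proof -
  interpret L: product_sigma_finite "\<lambda>_::nat. lborel :: real measure" by (rule product_sigma_finite_lborel)
  interpret G: product_sigma_finite "\<lambda>_::nat. std_normal" by (rule product_sigma_finite_std_normal)
  show ?thesis
    unfolding gauss_vec_def
  proof (rule G.PiM_eqI[symmetric])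
    show "sets (density (lebesgue_vec n) (gauss_pdf 1 n)) = sets (PiM {..<n} (\<lambda>_. std_normal))"
      by (simp add: sets_lebesgue_vec gauss_vec_def[symmetric] sets_gauss_vec)
    fix A :: "nat \<Rightarrow> real set" assume A: "\<And>i. i \<in> {..<n} \<Longrightarrow> A i \<in> sets std_normal"
    then have [measurable]: "Pi\<^sub>E {..<n} A \<in> sets (lebesgue_vec n)"
      by (auto simp: sets_lebesgue_vec intro!: sets_PiM_I_finite)
    have "emeasure (density (lebesgue_vec n) (gauss_pdf 1 n)) (Pi\<^sub>E {..<n} A)
      = (\<integral>\<^sup>+x. ennreal (gauss_pdf 1 n x) * indicator (Pi\<^sub>E {..<n} A) x \<partial>lebesgue_vec n)"
      by (rule emeasure_density) measurable
    also have "\<dots> = (\<integral>\<^sup>+x. (\<Prod>i<n. ennreal (std_normal_density (x i)) * indicator (A i) (x i)) \<partial>lebesgue_vec n)"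
    proof (intro nn_integral_cong)
      fix x assume "x \<in> space (lebesgue_vec n)"
      \<comment> \<open>\<open>Pi\<^sub>E\<close> also demands extensionality; on the space this is
        automatic, which leaves a product of coordinatewise indicators.\<close>
      then have "x \<in> extensional {..<n}" by (simp add: lebesgue_vec_def space_PiM PiE_def)
      then have "indicator (Pi\<^sub>E {..<n} A) x = (\<Prod>i<n. indicator (A i) (x i) :: ennreal)"
        by (cases "\<forall>i<n. x i \<in> A i") (auto simp: PiE_iff prod_zero_iff indicator_def)
      then show "ennreal (gauss_pdf 1 n x) * indicator (Pi\<^sub>E {..<n} A) x
        = (\<Prod>i<n. ennreal (std_normal_density (x i)) * indicator (A i) (x i))"
        by (simp add: gauss_pdf_def prod.distrib prod_ennreal)
    qed
    also have "\<dots> = (\<Prod>i<n. \<integral>\<^sup>+x. ennreal (std_normal_density x) * indicator (A i) x \<partial>lborel)"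
      unfolding lebesgue_vec_def using A by (intro L.product_nn_integral_prod) auto
    also have "\<dots> = (\<Prod>i<n. emeasure std_normal (A i))"
      using A by (intro prod.cong refl emeasure_density[symmetric]) auto
    finally show "emeasure (density (lebesgue_vec n) (gauss_pdf 1 n)) (Pi\<^sub>E {..<n} A)
      = (\<Prod>i\<in>{..<n}. emeasure std_normal (A i))" .
  qed auto
qed

text \<open>Passes from the noise to the channel output. On the output side different messages share
  one integration variable, so sums over messages can be taken under the integral.\<close>

lemma nn_integral_gauss_vec_shift:
  assumes [measurable]: "H \<in> borel_measurable (PiM {..<n} (\<lambda>_. borel))"
  shows "(\<integral>\<^sup>+z. H (vec_shift n c z) \<partial>gauss_vec n)
    = (\<integral>\<^sup>+y. ennreal (gauss_pdf 1 n (\<lambda>t. y t - c t)) * H y \<partial>lebesgue_vec n)"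
proof -
  have "(\<integral>\<^sup>+z. H (vec_shift n c z) \<partial>gauss_vec n) = (\<integral>\<^sup>+z. ennreal (gauss_pdf 1 n z) * H (vec_shift n c z) \<partial>lebesgue_vec n)"
    unfolding gauss_vec_eq_density by (rule nn_integral_density) measurable
  also have "\<dots> = (\<integral>\<^sup>+z. ennreal (gauss_pdf 1 n (\<lambda>t. vec_shift n c z t - c t)) * H (vec_shift n c z) \<partial>lebesgue_vec n)"
    by (intro nn_integral_cong arg_cong2[where f="(*)"] arg_cong[where f=ennreal] gauss_pdf_cong)
       (auto simp: vec_shift_def)
  also have "\<dots> = (\<integral>\<^sup>+y. ennreal (gauss_pdf 1 n (\<lambda>t. y t - c t)) * H y \<partial>lebesgue_vec n)"
    by (rule nn_integral_vec_shift) measurable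
  finally show ?thesis .
qed

lemma nn_integral_gauss_pdf:
  assumes "v > 0"
  shows "(\<integral>\<^sup>+y. ennreal (gauss_pdf v n (\<lambda>t. y t - c t)) \<partial>lebesgue_vec n) = 1"
proof -
  interpret L: product_sigma_finite "\<lambda>_::nat. lborel :: real measure" by (rule product_sigma_finite_lborel)
  have 1: "(\<integral>\<^sup>+x. ennreal (normal_density 0 (sqrt v) (x - a)) \<partial>lborel) = 1" for a
  proof -
    have "(\<integral>\<^sup>+x. ennreal (normal_density 0 (sqrt v) (x - a)) \<partial>lborel) = (\<integral>\<^sup>+x. ennreal (normal_density a (sqrt v) x) \<partial>lborel)"
      by (simp add: normal_density_def)
    also have "\<dots> = ennreal (\<integral>x. normal_density a (sqrt v) x \<partial>lborel)"
      using assms by (intro nn_integral_eq_integral) auto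
    finally show ?thesis using assms by simp
  qed
  have "(\<integral>\<^sup>+y. ennreal (gauss_pdf v n (\<lambda>t. y t - c t)) \<partial>lebesgue_vec n)
     = (\<integral>\<^sup>+y. (\<Prod>t<n. ennreal (normal_density 0 (sqrt v) (y t - c t))) \<partial>lebesgue_vec n)"
    by (simp add: gauss_pdf_def prod_ennreal)
  also have "\<dots> = (\<Prod>t<n. \<integral>\<^sup>+x. ennreal (normal_density 0 (sqrt v) (x - c t)) \<partial>lborel)"
    unfolding lebesgue_vec_def by (intro L.product_nn_integral_prod) auto
  finally show ?thesis by (simp add: 1)
qed

section \<open>Moments and linear combinations\<close>

lemma distr_pair_snd:
  assumes "prob_space M" "prob_space N"
  shows "distr (M \<Otimes>\<^sub>M N) N snd = N"
proof -
  interpret M: prob_space M by fact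
  interpret N: prob_space N by fact
  interpret pair_sigma_finite M N ..
  have "distr (M \<Otimes>\<^sub>M N) N snd = distr (distr (N \<Otimes>\<^sub>M M) (M \<Otimes>\<^sub>M N) (\<lambda>(x, y). (y, x))) N snd"
    using distr_pair_swap by simp
  also have "\<dots> = distr (N \<Otimes>\<^sub>M M) N (snd \<circ> (\<lambda>(x, y). (y, x)))"
    by (rule distr_distr) auto
  also have "snd \<circ> (\<lambda>(x, y). (y, x)) = fst"
    by auto
  finally show ?thesis by (simp add: M.distr_pair_fst)
qed

lemma
  fixes f :: "'a \<Rightarrow> real"
  assumes M: "prob_space M" and N: "prob_space N" and f: "integrable M f"
  shows integrable_pair_fst: "integrable (M \<Otimes>\<^sub>M N) (\<lambda>p. f (fst p))"
    and integral_pair_fst: "(\<integral>p. f (fst p) \<partial>(M \<Otimes>\<^sub>M N)) = integral\<^sup>L M f"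
proof -
  have d: "distr (M \<Otimes>\<^sub>M N) M fst = M"
    using N by (rule prob_space.distr_pair_fst)
  show "integrable (M \<Otimes>\<^sub>M N) (\<lambda>p. f (fst p))"
    by (rule integrable_distr[of fst _ M]) (simp_all add: d f)
  have "integral\<^sup>L (distr (M \<Otimes>\<^sub>M N) M fst) f = (\<integral>p. f (fst p) \<partial>(M \<Otimes>\<^sub>M N))"
    using f by (intro integral_distr) auto
  then show "(\<integral>p. f (fst p) \<partial>(M \<Otimes>\<^sub>M N)) = integral\<^sup>L M f" by (simp add: d)
qed

lemma
  fixes f :: "'b \<Rightarrow> real"
  assumes M: "prob_space M" and N: "prob_space N" and f: "integrable N f"
  shows integrable_pair_snd: "integrable (M \<Otimes>\<^sub>M N) (\<lambda>p. f (snd p))"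
    and integral_pair_snd: "(\<integral>p. f (snd p) \<partial>(M \<Otimes>\<^sub>M N)) = integral\<^sup>L N f"
proof -
  note d = distr_pair_snd[OF M N]
  show "integrable (M \<Otimes>\<^sub>M N) (\<lambda>p. f (snd p))"
    by (rule integrable_distr[of snd _ N]) (simp_all add: d f)
  have "integral\<^sup>L (distr (M \<Otimes>\<^sub>M N) N snd) f = (\<integral>p. f (snd p) \<partial>(M \<Otimes>\<^sub>M N))"
    using f by (intro integral_distr) auto
  then show "(\<integral>p. f (snd p) \<partial>(M \<Otimes>\<^sub>M N)) = integral\<^sup>L N f" by (simp add: d)
qed

lemma
  shows integrable_std_normal: "integrable std_normal (\<lambda>x. x ^ k)"
    and integral_std_normal_1: "(\<integral>x. x \<partial>std_normal) = 0"
    and integral_std_normal_2: "(\<integral>x. x\<^sup>2 \<partial>std_normal) = 1"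
  using integrable_std_normal_moment[of k] integral_std_normal_moment_odd[of 0]
    integral_std_normal_moment_even[of 1]
  by (simp_all add: integrable_density integral_density fact_numeral)

lemma
  fixes f :: "real \<Rightarrow> real"
  assumes t: "t < n" and f: "integrable std_normal f"
  shows integrable_gauss_vec_component: "integrable (gauss_vec n) (\<lambda>z. f (z t))"
    and integral_gauss_vec_component: "(\<integral>z. f (z t) \<partial>gauss_vec n) = integral\<^sup>L std_normal f"
proof -
  have d: "distr (gauss_vec n) std_normal (\<lambda>z. z t) = std_normal"
    unfolding gauss_vec_def using t
    by (intro distr_PiM_component[where M="\<lambda>_. std_normal"] prob_space_std_normal) auto
  have m: "(\<lambda>z. z t) \<in> measurable (gauss_vec n) std_normal"
    using t by (simp add: measurable_gauss_vec_component)
  show "integrable (gauss_vec n) (\<lambda>z. f (z t))"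
    by (rule integrable_distr[OF m]) (simp add: d f)
  have "integral\<^sup>L (distr (gauss_vec n) std_normal (\<lambda>z. z t)) f = (\<integral>z. f (z t) \<partial>gauss_vec n)"
    using f by (intro integral_distr m) auto
  then show "(\<integral>z. f (z t) \<partial>gauss_vec n) = integral\<^sup>L std_normal f" by (simp add: d)
qed

text \<open>Each Gaussian reference is evaluated at an affine combination of the two noises, and its
  logarithm is quadratic; this second moment is all that such logarithms require.\<close>

lemma
  fixes c \<alpha> \<beta> :: real
  assumes t: "t < n"
  shows integrable_gauss_pair_square:
      "integrable (gauss_vec n \<Otimes>\<^sub>M gauss_vec n) (\<lambda>p. (c + \<alpha> * fst p t + \<beta> * snd p t)\<^sup>2)"
    and integral_gauss_pair_square:
      "(\<integral>p. (c + \<alpha> * fst p t + \<beta> * snd p t)\<^sup>2 \<partial>(gauss_vec n \<Otimes>\<^sub>M gauss_vec n)) = c\<^sup>2 + \<alpha>\<^sup>2 + \<beta>\<^sup>2"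
proof -
  let ?G = "gauss_vec n" and ?P = "gauss_vec n \<Otimes>\<^sub>M gauss_vec n"
  interpret G: prob_space ?G by (rule prob_space_gauss_vec)
  interpret P: pair_prob_space ?G ?G ..
  note measurable_gauss_vec_component[OF t, measurable]
  have i1: "integrable ?G (\<lambda>z. z t)" and i2: "integrable ?G (\<lambda>z. (z t)\<^sup>2)"
    using integrable_gauss_vec_component[OF t integrable_std_normal[of 1]]
      integrable_gauss_vec_component[OF t integrable_std_normal[of 2]] by simp_all
  have e1: "(\<integral>z. z t \<partial>?G) = 0" and e2: "(\<integral>z. (z t)\<^sup>2 \<partial>?G) = 1"
    using integral_gauss_vec_component[OF t integrable_std_normal[of 1]]
      integral_gauss_vec_component[OF t integrable_std_normal[of 2]]
    by (simp_all add: integral_std_normal_1 integral_std_normal_2)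
  note pg = prob_space_gauss_vec[of n]
  note I = integrable_pair_fst[OF pg pg i1] integrable_pair_fst[OF pg pg i2]
    integrable_pair_snd[OF pg pg i1] integrable_pair_snd[OF pg pg i2]
  note E = integral_pair_fst[OF pg pg i1] integral_pair_fst[OF pg pg i2]
    integral_pair_snd[OF pg pg i1] integral_pair_snd[OF pg pg i2]
  have I12: "integrable ?P (\<lambda>p. fst p t * snd p t)"
  proof (rule Bochner_Integration.integrable_bound)
    show "integrable ?P (\<lambda>p. (fst p t)\<^sup>2 + (snd p t)\<^sup>2)"
      using I by simp
    show "AE p in ?P. norm (fst p t * snd p t) \<le> norm ((fst p t)\<^sup>2 + (snd p t)\<^sup>2)"
    proof (intro AE_I2)
      fix p :: "(nat \<Rightarrow> real) \<times> (nat \<Rightarrow> real)"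
      have "2 * \<bar>fst p t * snd p t\<bar> \<le> (fst p t)\<^sup>2 + (snd p t)\<^sup>2"
        using sum_squares_bound[of "\<bar>fst p t\<bar>" "\<bar>snd p t\<bar>"] by (simp add: abs_mult)
      then show "norm (fst p t * snd p t) \<le> norm ((fst p t)\<^sup>2 + (snd p t)\<^sup>2)"
        by simp
    qed
  qed (measurable)
  have E12: "(\<integral>p. fst p t * snd p t \<partial>?P) = 0"
    using P.integral_fst'[OF I12] by (simp add: e1)
  have eq: "(c + \<alpha> * fst p t + \<beta> * snd p t)\<^sup>2 = c\<^sup>2 + \<alpha>\<^sup>2 * (fst p t)\<^sup>2 + \<beta>\<^sup>2 * (snd p t)\<^sup>2
      + 2 * c * \<alpha> * fst p t + 2 * c * \<beta> * snd p t + 2 * \<alpha> * \<beta> * (fst p t * snd p t)" for p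
    by (simp add: power2_eq_square algebra_simps)
  show "integrable ?P (\<lambda>p. (c + \<alpha> * fst p t + \<beta> * snd p t)\<^sup>2)"
    unfolding eq using I I12 by simp
  show "(\<integral>p. (c + \<alpha> * fst p t + \<beta> * snd p t)\<^sup>2 \<partial>?P) = c\<^sup>2 + \<alpha>\<^sup>2 + \<beta>\<^sup>2"
    unfolding eq using I I12 by (simp add: E E12 e1 e2 P.prob_space)
qed

lemma distr_std_normal_combination:
  fixes \<alpha> \<beta> :: real
  assumes "\<alpha> > 0" "\<beta> \<ge> 0" "\<alpha>\<^sup>2 + \<beta>\<^sup>2 = 1"
  shows "distr (std_normal \<Otimes>\<^sub>M std_normal) borel (\<lambda>p. \<alpha> * fst p + \<beta> * snd p) = std_normal"
proof -
  let ?P = "std_normal \<Otimes>\<^sub>M std_normal"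
  interpret N: prob_space std_normal by (rule prob_space_std_normal)
  interpret P: pair_prob_space std_normal std_normal ..
  note pn = prob_space_std_normal
  have d1: "distr ?P lborel fst = std_normal"
    using N.distr_pair_fst[of std_normal] by (simp cong: distr_cong)
  have d2: "distr ?P lborel snd = std_normal"
    using distr_pair_snd[OF pn pn] by (simp cong: distr_cong)
  have D1: "distributed ?P lborel fst std_normal_density"
    and D2: "distributed ?P lborel snd std_normal_density"
    unfolding distributed_def using d1 d2 by auto
  show ?thesis
  \<comment> \<open>\<open>add_indep_normal\<close> adds two nondegenerate normals. The degenerate
    case arises for \<open>a1 = 1\<close>, where no fresh noise has to be added.\<close>
  proof (cases "\<beta> = 0")
    case True
    with assms have "\<alpha> = 1" by (simp add: power2_eq_1_iff)
    with True d1 show ?thesis by (simp cong: distr_cong)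
  next
    case False
    then have \<beta>: "\<beta> > 0" using assms by simp
    have "distr ?P borel fst \<Otimes>\<^sub>M distr ?P borel snd = distr ?P (borel \<Otimes>\<^sub>M borel) (\<lambda>p. (fst p, snd p))"
    proof -
      have "distr ?P borel fst = std_normal" "distr ?P borel snd = std_normal"
        using d1 d2 by (simp_all cong: distr_cong)
      moreover have "distr ?P (borel \<Otimes>\<^sub>M borel) (\<lambda>p. (fst p, snd p)) = ?P"
      proof -
        have "sets (borel \<Otimes>\<^sub>M borel) = sets ?P"
          by (intro sets_pair_measure_cong) auto
        from distr_id2[OF this] show ?thesis by simp
      qed
      ultimately show ?thesis by simp
    qed
    then have ind: "P.indep_var borel fst borel snd"
      unfolding P.indep_var_distribution_eq by simp
    have "P.indep_var borel ((*) \<alpha> \<circ> fst) borel ((*) \<beta> \<circ> snd)"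
      by (rule P.indep_var_compose[OF ind]) auto
    then have ind': "P.indep_var borel (\<lambda>p. \<alpha> * fst p) borel (\<lambda>p. \<beta> * snd p)"
      by (simp add: comp_def)
    have A: "distributed ?P lborel (\<lambda>p. \<alpha> * fst p) (normal_density 0 \<alpha>)"
      using P.normal_density_affine[OF D1, of \<alpha> 0] assms by simp
    have B: "distributed ?P lborel (\<lambda>p. \<beta> * snd p) (normal_density 0 \<beta>)"
      using P.normal_density_affine[OF D2, of \<beta> 0] \<beta> by simp
    have "distributed ?P lborel (\<lambda>p. \<alpha> * fst p + \<beta> * snd p) std_normal_density"
      using P.add_indep_normal[OF ind' \<open>\<alpha> > 0\<close> \<beta> A B] assms by simp
    then show ?thesis
      unfolding distributed_def by (simp cong: distr_cong)
  qed
qed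

text \<open>With \<open>\<alpha> = 1 / a1\<close> this rebuilds unit noise for receiver 1 from the
  attenuated noise of receiver 2 and an independent vector.\<close>

lemma distr_gauss_vec_combination:
  fixes \<alpha> \<beta> :: real
  assumes "\<alpha> > 0" "\<beta> \<ge> 0" "\<alpha>\<^sup>2 + \<beta>\<^sup>2 = 1"
  shows "distr (gauss_vec n \<Otimes>\<^sub>M gauss_vec n) (gauss_vec n)
    (\<lambda>p. \<lambda>t\<in>{..<n}. \<alpha> * fst p t + \<beta> * snd p t) = gauss_vec n"
    (is "distr ?P _ ?h = _")
proof -
  interpret N: prob_space std_normal by (rule prob_space_std_normal)
  interpret PN: pair_prob_space std_normal std_normal ..
  interpret G: prob_space "gauss_vec n" by (rule prob_space_gauss_vec)
  interpret PS: product_sigma_finite "\<lambda>_::nat. std_normal" by (rule product_sigma_finite_std_normal)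
  have h[measurable]: "?h \<in> measurable ?P (gauss_vec n)" by measurable
  have "PiM {..<n} (\<lambda>_. std_normal) = distr ?P (gauss_vec n) ?h"
  proof (rule PS.PiM_eqI[symmetric])
    show "sets (distr ?P (gauss_vec n) ?h) = sets (PiM {..<n} (\<lambda>_. std_normal))"
      by (simp add: gauss_vec_def)
    fix A :: "nat \<Rightarrow> real set" assume "\<And>i. i \<in> {..<n} \<Longrightarrow> A i \<in> sets std_normal"
    then have A[measurable]: "\<And>i. i < n \<Longrightarrow> A i \<in> sets borel" by auto
    then have PA[measurable]: "Pi\<^sub>E {..<n} A \<in> sets (gauss_vec n)"
      by (auto simp: sets_gauss_vec intro!: sets_PiM_I_finite)
    have "emeasure (distr ?P (gauss_vec n) ?h) (Pi\<^sub>E {..<n} A)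
      = (\<integral>\<^sup>+p. indicator (Pi\<^sub>E {..<n} A) p \<partial>distr ?P (gauss_vec n) ?h)"
      by simp
    also have "\<dots> = (\<integral>\<^sup>+p. indicator (Pi\<^sub>E {..<n} A) (?h p) \<partial>?P)"
      by (rule nn_integral_distr) measurable
    also have "\<dots> = (\<integral>\<^sup>+p. (\<Prod>t<n. indicator (A t) (\<alpha> * fst p t + \<beta> * snd p t)) \<partial>?P)"
    proof (intro nn_integral_cong)
      fix p :: "(nat \<Rightarrow> real) \<times> (nat \<Rightarrow> real)"
      show "indicator (Pi\<^sub>E {..<n} A) (?h p) = (\<Prod>t<n. indicator (A t) (\<alpha> * fst p t + \<beta> * snd p t) :: ennreal)"
        by (cases "\<forall>i<n. \<alpha> * fst p i + \<beta> * snd p i \<in> A i") (auto simp: PiE_iff prod_zero_iff indicator_def)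
    qed
    also have "\<dots> = (\<integral>\<^sup>+x. (\<integral>\<^sup>+y. (\<Prod>t<n. indicator (A t) (\<alpha> * x t + \<beta> * y t)) \<partial>gauss_vec n) \<partial>gauss_vec n)"
      by (subst G.nn_integral_fst[symmetric]) auto
    also have "\<dots> = (\<integral>\<^sup>+x. (\<Prod>t<n. \<integral>\<^sup>+y. indicator (A t) (\<alpha> * x t + \<beta> * y) \<partial>std_normal) \<partial>gauss_vec n)"
      unfolding gauss_vec_def by (intro nn_integral_cong PS.product_nn_integral_prod) auto
    also have "\<dots> = (\<Prod>t<n. \<integral>\<^sup>+x. (\<integral>\<^sup>+y. indicator (A t) (\<alpha> * x + \<beta> * y) \<partial>std_normal) \<partial>std_normal)"
      unfolding gauss_vec_def by (intro PS.product_nn_integral_prod) auto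
    also have "\<dots> = (\<Prod>t<n. emeasure std_normal (A t))"
    proof (intro prod.cong refl)
      fix t assume t: "t \<in> {..<n}"
      then have [measurable]: "A t \<in> sets borel" by auto
      have "(\<integral>\<^sup>+x. (\<integral>\<^sup>+y. indicator (A t) (\<alpha> * x + \<beta> * y) \<partial>std_normal) \<partial>std_normal)
        = (\<integral>\<^sup>+p. indicator (A t) (\<alpha> * fst p + \<beta> * snd p) \<partial>(std_normal \<Otimes>\<^sub>M std_normal))"
        by (subst N.nn_integral_fst[symmetric]) auto
      also have "\<dots> = (\<integral>\<^sup>+x. indicator (A t) x \<partial>distr (std_normal \<Otimes>\<^sub>M std_normal) borel (\<lambda>p. \<alpha> * fst p + \<beta> * snd p))"
        by (rule nn_integral_distr[symmetric]) measurable
      also have "\<dots> = emeasure std_normal (A t)"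
        unfolding distr_std_normal_combination[OF assms] by simp
      finally show "(\<integral>\<^sup>+x. (\<integral>\<^sup>+y. indicator (A t) (\<alpha> * x + \<beta> * y) \<partial>std_normal) \<partial>std_normal) = emeasure std_normal (A t)" .
    qed
    finally show "emeasure (distr ?P (gauss_vec n) ?h) (Pi\<^sub>E {..<n} A) = (\<Prod>i\<in>{..<n}. emeasure std_normal (A i))" .
  qed auto
  then show ?thesis by (simp add: gauss_vec_def[symmetric])
qed

lemma distr_noise_measure_user:
  assumes "i < 3"
  shows "distr (noise_measure n) (gauss_vec n) (\<lambda>z. \<lambda>t\<in>{..<n}. z (i, t)) = gauss_vec n"
  unfolding noise_measure_def gauss_vec_def using assms
  by (intro distr_PiM_reindex[where M="\<lambda>_. std_normal" and f="\<lambda>t. (i, t)"] prob_space_std_normal)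
     (auto intro: inj_onI)

section \<open>Density ratios with expectation at most one\<close>

lemma gauss_pdf_vec_shift: "gauss_pdf v n (\<lambda>t. vec_shift n c z t - c t) = gauss_pdf v n z"
  by (rule gauss_pdf_cong) (simp add: vec_shift_def)

text \<open>Given the transmitted point \<open>c\<close>, the divisor is the conditional density of
  the output, so it cancels the weight produced by the change of variables.\<close>

lemma nn_integral_gauss_vec_ratio:
  assumes [measurable]: "f \<in> borel_measurable (PiM {..<n} (\<lambda>_. borel))"
    and "\<And>y. f y \<ge> (0::real)"
  shows "(\<integral>\<^sup>+z. ennreal (f (vec_shift n c z) / gauss_pdf 1 n z) \<partial>gauss_vec n) = (\<integral>\<^sup>+y. ennreal (f y) \<partial>lebesgue_vec n)"
proof -
  have "(\<integral>\<^sup>+z. ennreal (f (vec_shift n c z) / gauss_pdf 1 n z) \<partial>gauss_vec n)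
    = (\<integral>\<^sup>+z. (\<lambda>y. ennreal (f y / gauss_pdf 1 n (\<lambda>t. y t - c t))) (vec_shift n c z) \<partial>gauss_vec n)"
    by (simp add: gauss_pdf_vec_shift)
  also have "\<dots> = (\<integral>\<^sup>+y. ennreal (gauss_pdf 1 n (\<lambda>t. y t - c t)) * ennreal (f y / gauss_pdf 1 n (\<lambda>t. y t - c t)) \<partial>lebesgue_vec n)"
    by (rule nn_integral_gauss_vec_shift) measurable
  also have "\<dots> = (\<integral>\<^sup>+y. ennreal (f y) \<partial>lebesgue_vec n)"
    using gauss_pdf_pos[of 1 n]
    by (intro nn_integral_cong) (simp add: ennreal_mult'[symmetric] gauss_pdf_nonneg assms less_imp_neq[symmetric])
  finally show ?thesis .
qed

section \<open>Output densities of a code and the four density ratios\<close>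

locale codebooks =
  fixes a1 a2 :: real and n M1 M2 M3 :: nat and x1 x2 x3 :: "nat \<Rightarrow> nat \<Rightarrow> real"
  assumes M1: "M1 \<ge> 1" and M2: "M2 \<ge> 1" and M3: "M3 \<ge> 1"
begin

sublocale G: prob_space "gauss_vec n" by (rule prob_space_gauss_vec)
sublocale L: sigma_finite_measure "lebesgue_vec n" by (rule sigma_finite_lebesgue_vec)
sublocale GL: pair_sigma_finite "gauss_vec n" "lebesgue_vec n" ..
sublocale LL: pair_sigma_finite "lebesgue_vec n" "lebesgue_vec n" ..

text \<open>The densities of \<open>V\<close>, \<open>U\<close> and \<open>S\<close> for independent uniform messages.\<close>

definition pdfV :: "(nat \<Rightarrow> real) \<Rightarrow> real" where
  "pdfV y = (\<Sum>i<M1. \<Sum>j<M2. gauss_pdf 1 n (\<lambda>t. y t - (a1 * x1 i t + x2 j t))) / (real M1 * real M2)"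

definition pdfU :: "(nat \<Rightarrow> real) \<Rightarrow> real" where
  "pdfU y = (\<Sum>j<M2. gauss_pdf 1 n (\<lambda>t. y t - a2 * x2 j t)) / real M2"

definition pdfS :: "(nat \<Rightarrow> real) \<Rightarrow> real" where
  "pdfS y = (\<Sum>i<M1. \<integral>z. pdfU (\<lambda>t. y t - a2 * (a1 * x1 i t + z t)) \<partial>gauss_vec n) / real M1"

lemma measurable_pdfV [measurable (raw)]:
  "(\<And>t. t < n \<Longrightarrow> (\<lambda>w. y w t) \<in> borel_measurable N) \<Longrightarrow> (\<lambda>w. pdfV (y w)) \<in> borel_measurable N"
  unfolding pdfV_def
  by (intro borel_measurable_divide borel_measurable_sum measurable_gauss_pdf borel_measurable_diff) auto

lemma measurable_pdfU [measurable (raw)]: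
  "(\<And>t. t < n \<Longrightarrow> (\<lambda>w. y w t) \<in> borel_measurable N) \<Longrightarrow> (\<lambda>w. pdfU (y w)) \<in> borel_measurable N"
  unfolding pdfU_def
  by (intro borel_measurable_divide borel_measurable_sum measurable_gauss_pdf borel_measurable_diff) auto

lemma measurable_pdfS [measurable]: "pdfS \<in> borel_measurable (PiM {..<n} (\<lambda>_. borel))"
  unfolding pdfS_def by measurable

lemma pdfV_pos: "pdfV y > 0"
  unfolding pdfV_def using M1 M2
  by (intro divide_pos_pos sum_pos gauss_pdf_pos) (auto simp: lessThan_empty_iff)

lemma pdfU_pos: "pdfU y > 0"
  unfolding pdfU_def using M2
  by (intro divide_pos_pos sum_pos gauss_pdf_pos) (auto simp: lessThan_empty_iff)

lemma pdfU_le: "pdfU y \<le> 1"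
proof -
  have "(\<Sum>j<M2. gauss_pdf 1 n (\<lambda>t. y t - a2 * x2 j t)) \<le> (\<Sum>j<M2. 1)"
    by (intro sum_mono gauss_pdf_le)
  then show ?thesis unfolding pdfU_def using M2 by simp
qed

lemma pdfU_cong: "(\<And>t. t < n \<Longrightarrow> y t = y' t) \<Longrightarrow> pdfU y = pdfU y'"
  unfolding pdfU_def by (intro arg_cong2[where f="(/)"] sum.cong gauss_pdf_cong refl) simp

lemma integrable_pdfU: "integrable (gauss_vec n) (\<lambda>z. pdfU (\<lambda>t. y t - a2 * (c t + z t)))"
  using pdfU_pos pdfU_le
  by (intro G.integrable_const_bound[where B=1] AE_I2) (auto simp: less_imp_le)

lemma pdfS_pos: "pdfS y > 0"
proof -
  have "(\<integral>z. pdfU (\<lambda>t. y t - a2 * (a1 * x1 i t + z t)) \<partial>gauss_vec n) > 0" for i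
  proof -
    let ?f = "\<lambda>z. pdfU (\<lambda>t. y t - a2 * (a1 * x1 i t + z t))"
    have "integral\<^sup>L (gauss_vec n) ?f \<noteq> 0"
    proof
      assume "integral\<^sup>L (gauss_vec n) ?f = 0"
      then have "AE z in gauss_vec n. ?f z = 0"
        using integral_nonneg_eq_0_iff_AE[OF integrable_pdfU, of y "\<lambda>t. a1 * x1 i t"] pdfU_pos
        by (simp add: less_imp_le)
      then have "AE z in gauss_vec n. False"
        using pdfU_pos by (simp add: less_imp_neq[symmetric])
      then show False by simp
    qed
    moreover have "integral\<^sup>L (gauss_vec n) ?f \<ge> 0"
      using pdfU_pos by (intro integral_nonneg_AE AE_I2) (auto simp: less_imp_le)
    ultimately show ?thesis by simp
  qed
  then show ?thesis
    unfolding pdfS_def using M1 by (intro divide_pos_pos sum_pos) (auto simp: lessThan_empty_iff)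
qed

text \<open>Averaging over uniform messages means integrating against the mixture density. The
  message counts stay as factors on the right, which avoids division in \<open>ennreal\<close>; the
  later bounds keep this form.\<close>

lemma sum_nn_integral_pdfV:
  assumes [measurable]: "H \<in> borel_measurable (PiM {..<n} (\<lambda>_. borel))"
  shows "(\<Sum>i<M1. \<Sum>j<M2. \<integral>\<^sup>+z. H (vec_shift n (\<lambda>t. a1 * x1 i t + x2 j t) z) \<partial>gauss_vec n)
    = of_nat M1 * of_nat M2 * (\<integral>\<^sup>+y. ennreal (pdfV y) * H y \<partial>lebesgue_vec n)"
proof -
  have "(\<Sum>i<M1. \<Sum>j<M2. \<integral>\<^sup>+z. H (vec_shift n (\<lambda>t. a1 * x1 i t + x2 j t) z) \<partial>gauss_vec n)
    = (\<Sum>i<M1. \<Sum>j<M2. \<integral>\<^sup>+y. ennreal (gauss_pdf 1 n (\<lambda>t. y t - (a1 * x1 i t + x2 j t))) * H y \<partial>lebesgue_vec n)"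
    by (intro sum.cong refl nn_integral_gauss_vec_shift assms)
  also have "\<dots> = (\<integral>\<^sup>+y. (\<Sum>i<M1. \<Sum>j<M2. ennreal (gauss_pdf 1 n (\<lambda>t. y t - (a1 * x1 i t + x2 j t))) * H y) \<partial>lebesgue_vec n)"
    by (simp add: nn_integral_sum)
  also have "\<dots> = (\<integral>\<^sup>+y. of_nat M1 * of_nat M2 * (ennreal (pdfV y) * H y) \<partial>lebesgue_vec n)"
  proof (intro nn_integral_cong)
    fix y
    have "(\<Sum>i<M1. \<Sum>j<M2. ennreal (gauss_pdf 1 n (\<lambda>t. y t - (a1 * x1 i t + x2 j t))) * H y)
      = ennreal (\<Sum>i<M1. \<Sum>j<M2. gauss_pdf 1 n (\<lambda>t. y t - (a1 * x1 i t + x2 j t))) * H y"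
      by (simp add: sum_distrib_right[symmetric] sum_ennreal gauss_pdf_nonneg sum_nonneg)
    also have "(\<Sum>i<M1. \<Sum>j<M2. gauss_pdf 1 n (\<lambda>t. y t - (a1 * x1 i t + x2 j t))) = real M1 * real M2 * pdfV y"
      unfolding pdfV_def using M1 M2 by simp
    also have "ennreal \<dots> = of_nat M1 * of_nat M2 * ennreal (pdfV y)"
      by (simp add: ennreal_mult' ennreal_of_nat_eq_real_of_nat mult.assoc)
    finally show "(\<Sum>i<M1. \<Sum>j<M2. ennreal (gauss_pdf 1 n (\<lambda>t. y t - (a1 * x1 i t + x2 j t))) * H y)
      = of_nat M1 * of_nat M2 * (ennreal (pdfV y) * H y)" by (simp add: mult.assoc)
  qed
  also have "\<dots> = of_nat M1 * of_nat M2 * (\<integral>\<^sup>+y. ennreal (pdfV y) * H y \<partial>lebesgue_vec n)"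
    by (rule nn_integral_cmult) measurable
  finally show ?thesis .
qed

lemma sum_nn_integral_pdfU:
  assumes [measurable]: "H \<in> borel_measurable (PiM {..<n} (\<lambda>_. borel))"
  shows "(\<Sum>j<M2. \<integral>\<^sup>+z. H (vec_shift n (\<lambda>t. a2 * x2 j t) z) \<partial>gauss_vec n)
    = of_nat M2 * (\<integral>\<^sup>+y. ennreal (pdfU y) * H y \<partial>lebesgue_vec n)"
proof -
  have "(\<Sum>j<M2. \<integral>\<^sup>+z. H (vec_shift n (\<lambda>t. a2 * x2 j t) z) \<partial>gauss_vec n)
    = (\<Sum>j<M2. \<integral>\<^sup>+y. ennreal (gauss_pdf 1 n (\<lambda>t. y t - a2 * x2 j t)) * H y \<partial>lebesgue_vec n)"
    by (intro sum.cong refl nn_integral_gauss_vec_shift assms)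
  also have "\<dots> = (\<integral>\<^sup>+y. (\<Sum>j<M2. ennreal (gauss_pdf 1 n (\<lambda>t. y t - a2 * x2 j t)) * H y) \<partial>lebesgue_vec n)"
    by (simp add: nn_integral_sum)
  also have "\<dots> = (\<integral>\<^sup>+y. of_nat M2 * (ennreal (pdfU y) * H y) \<partial>lebesgue_vec n)"
  proof (intro nn_integral_cong)
    fix y
    have "(\<Sum>j<M2. ennreal (gauss_pdf 1 n (\<lambda>t. y t - a2 * x2 j t)) * H y)
      = ennreal (\<Sum>j<M2. gauss_pdf 1 n (\<lambda>t. y t - a2 * x2 j t)) * H y"
      by (simp add: sum_distrib_right[symmetric] sum_ennreal gauss_pdf_nonneg)
    also have "(\<Sum>j<M2. gauss_pdf 1 n (\<lambda>t. y t - a2 * x2 j t)) = real M2 * pdfU y"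
      unfolding pdfU_def using M2 by simp
    also have "ennreal \<dots> = of_nat M2 * ennreal (pdfU y)"
      by (simp add: ennreal_mult' ennreal_of_nat_eq_real_of_nat)
    finally show "(\<Sum>j<M2. ennreal (gauss_pdf 1 n (\<lambda>t. y t - a2 * x2 j t)) * H y)
      = of_nat M2 * (ennreal (pdfU y) * H y)" by (simp add: mult.assoc)
  qed
  also have "\<dots> = of_nat M2 * (\<integral>\<^sup>+y. ennreal (pdfU y) * H y \<partial>lebesgue_vec n)"
    by (rule nn_integral_cmult) measurable
  finally show ?thesis .
qed

lemma nn_integral_pdfU_translate: "(\<integral>\<^sup>+y. ennreal (pdfU (\<lambda>t. y t - c t)) \<partial>lebesgue_vec n) = 1"
proof -
  have "of_nat M2 * (\<integral>\<^sup>+y. ennreal (pdfU (\<lambda>t. y t - c t)) \<partial>lebesgue_vec n)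
    = (\<integral>\<^sup>+y. of_nat M2 * ennreal (pdfU (\<lambda>t. y t - c t)) \<partial>lebesgue_vec n)"
    by (rule nn_integral_cmult[symmetric]) measurable
  also have "\<dots> = (\<integral>\<^sup>+y. (\<Sum>j<M2. ennreal (gauss_pdf 1 n (\<lambda>t. y t - (c t + a2 * x2 j t)))) \<partial>lebesgue_vec n)"
  proof (intro nn_integral_cong)
    fix y
    have "of_nat M2 * ennreal (pdfU (\<lambda>t. y t - c t)) = ennreal (real M2 * pdfU (\<lambda>t. y t - c t))"
      by (simp add: ennreal_mult' ennreal_of_nat_eq_real_of_nat)
    also have "real M2 * pdfU (\<lambda>t. y t - c t) = (\<Sum>j<M2. gauss_pdf 1 n (\<lambda>t. y t - (c t + a2 * x2 j t)))"
      unfolding pdfU_def using M2 by (simp add: diff_diff_eq)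
    finally show "of_nat M2 * ennreal (pdfU (\<lambda>t. y t - c t)) = (\<Sum>j<M2. ennreal (gauss_pdf 1 n (\<lambda>t. y t - (c t + a2 * x2 j t))))"
      by (simp add: sum_ennreal gauss_pdf_nonneg)
  qed
  also have "\<dots> = (\<Sum>j<M2. \<integral>\<^sup>+y. ennreal (gauss_pdf 1 n (\<lambda>t. y t - (c t + a2 * x2 j t))) \<partial>lebesgue_vec n)"
    by (rule nn_integral_sum) measurable
  also have "\<dots> = of_nat M2 * 1"
    by (simp add: nn_integral_gauss_pdf)
  finally show ?thesis
    using M2 by (subst (asm) ennreal_mult_cancel_left) auto
qed

text \<open>Since S = U + a2 (a1 X1 + Z2), its density is the average of translates of
  \<open>pdfU\<close>. This carries the Bochner form of that fact over to
  \<open>ennreal\<close>.\<close>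

lemma sum_nn_integral_pdfS:
  "(\<Sum>i<M1. \<integral>\<^sup>+z. ennreal (pdfU (\<lambda>t. y t - a2 * (a1 * x1 i t + z t))) \<partial>gauss_vec n) = of_nat M1 * ennreal (pdfS y)"
proof -
  have "(\<Sum>i<M1. \<integral>\<^sup>+z. ennreal (pdfU (\<lambda>t. y t - a2 * (a1 * x1 i t + z t))) \<partial>gauss_vec n)
    = (\<Sum>i<M1. ennreal (\<integral>z. pdfU (\<lambda>t. y t - a2 * (a1 * x1 i t + z t)) \<partial>gauss_vec n))"
    using pdfU_pos by (intro sum.cong refl nn_integral_eq_integral integrable_pdfU) (auto simp: less_imp_le)
  also have "\<dots> = ennreal (\<Sum>i<M1. \<integral>z. pdfU (\<lambda>t. y t - a2 * (a1 * x1 i t + z t)) \<partial>gauss_vec n)"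
    using pdfU_pos by (intro sum_ennreal integral_nonneg_AE AE_I2) (auto simp: less_imp_le)
  also have "\<dots> = ennreal (real M1 * pdfS y)"
    unfolding pdfS_def using M1 by simp
  finally show ?thesis
    by (simp add: ennreal_mult' ennreal_of_nat_eq_real_of_nat)
qed

lemma nn_integral_pdfS: "(\<integral>\<^sup>+y. ennreal (pdfS y) \<partial>lebesgue_vec n) = 1"
proof -
  have "of_nat M1 * (\<integral>\<^sup>+y. ennreal (pdfS y) \<partial>lebesgue_vec n) = (\<integral>\<^sup>+y. of_nat M1 * ennreal (pdfS y) \<partial>lebesgue_vec n)"
    by (rule nn_integral_cmult[symmetric]) measurable
  also have "\<dots> = (\<Sum>i<M1. \<integral>\<^sup>+y. \<integral>\<^sup>+z. ennreal (pdfU (\<lambda>t. y t - a2 * (a1 * x1 i t + z t))) \<partial>gauss_vec n \<partial>lebesgue_vec n)"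
    by (subst nn_integral_sum[symmetric]) (simp_all add: sum_nn_integral_pdfS)
  also have "\<dots> = (\<Sum>i<M1. \<integral>\<^sup>+z. \<integral>\<^sup>+y. ennreal (pdfU (\<lambda>t. y t - a2 * (a1 * x1 i t + z t))) \<partial>lebesgue_vec n \<partial>gauss_vec n)"
    by (intro sum.cong refl GL.Fubini') measurable
  also have "\<dots> = of_nat M1 * 1"
    by (simp add: nn_integral_pdfU_translate G.emeasure_space_1)
  finally show ?thesis
    using M1 by (subst (asm) ennreal_mult_cancel_left) auto
qed

text \<open>After the conditional density cancels, what remains is \<open>pdfV\<close> times the
  total weight, and the weights divided by \<open>M1 * M2\<close> form a subprobability on message
  pairs. In logarithms: the mean of \<open>ln r\<close> is at most h(V) - h(Z2).\<close>

lemma gibbs_receiver2: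
  assumes [measurable]: "\<And>i j. r i j \<in> borel_measurable (PiM {..<n} (\<lambda>_. borel))"
    and r0: "\<And>i j y. r i j y \<ge> (0::real)"
    and r1: "\<And>y. (\<Sum>i<M1. \<Sum>j<M2. r i j y) \<le> real M1 * real M2"
  shows "(\<Sum>i<M1. \<Sum>j<M2. \<integral>\<^sup>+z. ennreal (r i j (vec_shift n (\<lambda>t. a1 * x1 i t + x2 j t) z)
      * pdfV (vec_shift n (\<lambda>t. a1 * x1 i t + x2 j t) z) / gauss_pdf 1 n z) \<partial>gauss_vec n)
    \<le> of_nat M1 * of_nat M2"
proof -
  have "(\<Sum>i<M1. \<Sum>j<M2. \<integral>\<^sup>+z. ennreal (r i j (vec_shift n (\<lambda>t. a1 * x1 i t + x2 j t) z)
      * pdfV (vec_shift n (\<lambda>t. a1 * x1 i t + x2 j t) z) / gauss_pdf 1 n z) \<partial>gauss_vec n)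
    = (\<Sum>i<M1. \<Sum>j<M2. \<integral>\<^sup>+y. ennreal (r i j y * pdfV y) \<partial>lebesgue_vec n)"
    using r0 pdfV_pos by (intro sum.cong refl nn_integral_gauss_vec_ratio) (auto simp: less_imp_le)
  also have "\<dots> = (\<integral>\<^sup>+y. (\<Sum>i<M1. \<Sum>j<M2. ennreal (r i j y * pdfV y)) \<partial>lebesgue_vec n)"
    by (simp add: nn_integral_sum)
  also have "\<dots> \<le> (\<integral>\<^sup>+y. of_nat M1 * of_nat M2 * (ennreal (pdfV y) * 1) \<partial>lebesgue_vec n)"
  proof (intro nn_integral_mono)
    fix y
    have "(\<Sum>i<M1. \<Sum>j<M2. ennreal (r i j y * pdfV y)) = ennreal ((\<Sum>i<M1. \<Sum>j<M2. r i j y) * pdfV y)"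
      using r0 pdfV_pos by (simp add: sum_ennreal sum_nonneg less_imp_le sum_distrib_right)
    also have "\<dots> \<le> ennreal (real M1 * real M2 * pdfV y)"
      using r1 pdfV_pos by (intro ennreal_leI mult_right_mono) (auto simp: less_imp_le)
    finally show "(\<Sum>i<M1. \<Sum>j<M2. ennreal (r i j y * pdfV y)) \<le> of_nat M1 * of_nat M2 * (ennreal (pdfV y) * 1)"
      by (simp add: ennreal_mult' ennreal_of_nat_eq_real_of_nat mult.assoc)
  qed
  also have "\<dots> = of_nat M1 * of_nat M2 * (\<integral>\<^sup>+y. ennreal (pdfV y) * 1 \<partial>lebesgue_vec n)"
    by (rule nn_integral_cmult) measurable
  also have "\<dots> = of_nat M1 * of_nat M2"
    by (subst sum_nn_integral_pdfV[symmetric]) (simp_all add: G.emeasure_space_1)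
  finally show ?thesis .
qed

text \<open>The denominator is the true joint density of V and S. The numerator is another joint
  density: S with its own law, and V given S Gaussian with variance \<open>\<kappa>\<close> around
  an affine estimate. In logarithms this bounds h(V) + h(Z3) - h(S) = h(V | S) by the mean of minus
  the logarithm of that Gaussian.\<close>

lemma gibbs_estimation:
  assumes "\<kappa> > 0"
  shows "(\<Sum>i<M1. \<Sum>j<M2. \<integral>\<^sup>+z. \<integral>\<^sup>+w.
      (let v = vec_shift n (\<lambda>t. a1 * x1 i t + x2 j t) z; s = vec_shift n (\<lambda>t. a2 * v t) w in
       ennreal (pdfS s * gauss_pdf \<kappa> n (\<lambda>t. v t - (\<alpha> * s t + \<mu> t)) / (pdfV v * gauss_pdf 1 n w)))
      \<partial>gauss_vec n \<partial>gauss_vec n) = of_nat M1 * of_nat M2"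
proof -
  define H where "H v = (\<integral>\<^sup>+s. ennreal (pdfS s * gauss_pdf \<kappa> n (\<lambda>t. v t - (\<alpha> * s t + \<mu> t)) / pdfV v) \<partial>lebesgue_vec n)" for v
  have [measurable]: "H \<in> borel_measurable (PiM {..<n} (\<lambda>_. borel))"
    unfolding H_def by measurable
  have inner: "(\<integral>\<^sup>+w. (let s = vec_shift n (\<lambda>t. a2 * v t) w in
      ennreal (pdfS s * gauss_pdf \<kappa> n (\<lambda>t. v t - (\<alpha> * s t + \<mu> t)) / (pdfV v * gauss_pdf 1 n w))) \<partial>gauss_vec n) = H v" for v
    unfolding H_def Let_def
    by (subst nn_integral_gauss_vec_ratio[symmetric, where c="\<lambda>t. a2 * v t"])
       (auto simp: pdfS_pos pdfV_pos less_imp_le gauss_pdf_nonneg intro!: divide_nonneg_pos)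
  have "(\<Sum>i<M1. \<Sum>j<M2. \<integral>\<^sup>+z. \<integral>\<^sup>+w.
      (let v = vec_shift n (\<lambda>t. a1 * x1 i t + x2 j t) z; s = vec_shift n (\<lambda>t. a2 * v t) w in
       ennreal (pdfS s * gauss_pdf \<kappa> n (\<lambda>t. v t - (\<alpha> * s t + \<mu> t)) / (pdfV v * gauss_pdf 1 n w)))
      \<partial>gauss_vec n \<partial>gauss_vec n)
     = (\<Sum>i<M1. \<Sum>j<M2. \<integral>\<^sup>+z. H (vec_shift n (\<lambda>t. a1 * x1 i t + x2 j t) z) \<partial>gauss_vec n)"
    by (simp add: inner[symmetric] Let_def)
  also have "\<dots> = of_nat M1 * of_nat M2 * (\<integral>\<^sup>+v. ennreal (pdfV v) * H v \<partial>lebesgue_vec n)"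
    by (rule sum_nn_integral_pdfV) measurable
  also have "(\<integral>\<^sup>+v. ennreal (pdfV v) * H v \<partial>lebesgue_vec n)
     = (\<integral>\<^sup>+v. \<integral>\<^sup>+s. ennreal (pdfS s) * ennreal (gauss_pdf \<kappa> n (\<lambda>t. v t - (\<alpha> * s t + \<mu> t))) \<partial>lebesgue_vec n \<partial>lebesgue_vec n)"
    unfolding H_def
  proof (intro nn_integral_cong)
    fix v
    have "ennreal (pdfV v) * (\<integral>\<^sup>+s. ennreal (pdfS s * gauss_pdf \<kappa> n (\<lambda>t. v t - (\<alpha> * s t + \<mu> t)) / pdfV v) \<partial>lebesgue_vec n)
      = (\<integral>\<^sup>+s. ennreal (pdfV v) * ennreal (pdfS s * gauss_pdf \<kappa> n (\<lambda>t. v t - (\<alpha> * s t + \<mu> t)) / pdfV v) \<partial>lebesgue_vec n)"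
      by (rule nn_integral_cmult[symmetric]) measurable
    also have "\<dots> = (\<integral>\<^sup>+s. ennreal (pdfS s) * ennreal (gauss_pdf \<kappa> n (\<lambda>t. v t - (\<alpha> * s t + \<mu> t))) \<partial>lebesgue_vec n)"
      using pdfV_pos[of v] pdfS_pos
      by (intro nn_integral_cong) (simp add: ennreal_mult'[symmetric] less_imp_le gauss_pdf_nonneg)
    finally show "ennreal (pdfV v) * (\<integral>\<^sup>+s. ennreal (pdfS s * gauss_pdf \<kappa> n (\<lambda>t. v t - (\<alpha> * s t + \<mu> t)) / pdfV v) \<partial>lebesgue_vec n)
      = (\<integral>\<^sup>+s. ennreal (pdfS s) * ennreal (gauss_pdf \<kappa> n (\<lambda>t. v t - (\<alpha> * s t + \<mu> t))) \<partial>lebesgue_vec n)" .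
  qed
  also have "\<dots> = (\<integral>\<^sup>+s. \<integral>\<^sup>+v. ennreal (pdfS s) * ennreal (gauss_pdf \<kappa> n (\<lambda>t. v t - (\<alpha> * s t + \<mu> t))) \<partial>lebesgue_vec n \<partial>lebesgue_vec n)"
    by (rule LL.Fubini') measurable
  also have "\<dots> = (\<integral>\<^sup>+s. ennreal (pdfS s) * (\<integral>\<^sup>+v. ennreal (gauss_pdf \<kappa> n (\<lambda>t. v t - (\<alpha> * s t + \<mu> t))) \<partial>lebesgue_vec n) \<partial>lebesgue_vec n)"
    by (intro nn_integral_cong nn_integral_cmult) measurable
  also have "\<dots> = 1"
    using assms by (simp add: nn_integral_gauss_pdf nn_integral_pdfS)
  finally show ?thesis by simp
qed

text \<open>With T = a1 X1 + Z2, the factor \<open>pdfU\<close> is the density of S given T, and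
  \<open>gauss_pdf 1 n w\<close> is that of S given T and X2. The logarithmic form is I(T; S) \<le>
  I(T; S | X2), valid as T is independent of X2, with a Gaussian reference for S given X2.\<close>

lemma gibbs_data_processing:
  assumes "\<psi> > 0"
  shows "(\<Sum>i<M1. \<Sum>j<M2. \<integral>\<^sup>+z. \<integral>\<^sup>+w.
      (let v = vec_shift n (\<lambda>t. a1 * x1 i t + x2 j t) z; s = vec_shift n (\<lambda>t. a2 * v t) w in
       ennreal (gauss_pdf \<psi> n (\<lambda>t. s t - (a2 * x2 j t + \<mu> t)) * pdfU (\<lambda>t. s t - a2 * (a1 * x1 i t + z t))
         / (pdfS s * gauss_pdf 1 n w)))
      \<partial>gauss_vec n \<partial>gauss_vec n) = of_nat M1 * of_nat M2"
proof -
  let ?g = "\<lambda>j s. gauss_pdf \<psi> n (\<lambda>t. s t - (a2 * x2 j t + \<mu> t))"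
  let ?u = "\<lambda>i s z. pdfU (\<lambda>t. s t - a2 * (a1 * x1 i t + z t))"
  have inner: "(\<integral>\<^sup>+w. (let s = vec_shift n c w in ennreal (?g j s * ?u i s z / (pdfS s * gauss_pdf 1 n w))) \<partial>gauss_vec n)
     = (\<integral>\<^sup>+s. ennreal (?g j s / pdfS s) * ennreal (?u i s z) \<partial>lebesgue_vec n)"
    if "z \<in> space (gauss_vec n)" for c i j z
  proof -
    have "(\<integral>\<^sup>+w. (let s = vec_shift n c w in ennreal (?g j s * ?u i s z / (pdfS s * gauss_pdf 1 n w))) \<partial>gauss_vec n)
      = (\<integral>\<^sup>+s. ennreal (?g j s * ?u i s z / pdfS s) \<partial>lebesgue_vec n)"
      by (subst nn_integral_gauss_vec_ratio[symmetric, where c=c])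
         (auto simp: Let_def pdfS_pos pdfU_pos less_imp_le gauss_pdf_nonneg intro!: divide_nonneg_pos mult_nonneg_nonneg)
    also have "\<dots> = (\<integral>\<^sup>+s. ennreal (?g j s / pdfS s) * ennreal (?u i s z) \<partial>lebesgue_vec n)"
      using pdfS_pos pdfU_pos by (simp add: ennreal_mult'[symmetric] less_imp_le gauss_pdf_nonneg)
    finally show ?thesis .
  qed
  have "(\<Sum>i<M1. \<Sum>j<M2. \<integral>\<^sup>+z. \<integral>\<^sup>+w.
      (let v = vec_shift n (\<lambda>t. a1 * x1 i t + x2 j t) z; s = vec_shift n (\<lambda>t. a2 * v t) w in
       ennreal (?g j s * ?u i s z / (pdfS s * gauss_pdf 1 n w))) \<partial>gauss_vec n \<partial>gauss_vec n)
    = (\<Sum>i<M1. \<Sum>j<M2. \<integral>\<^sup>+z. \<integral>\<^sup>+s. ennreal (?g j s / pdfS s) * ennreal (?u i s z) \<partial>lebesgue_vec n \<partial>gauss_vec n)"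
    unfolding Let_def[of "vec_shift n (\<lambda>t. a1 * x1 _ t + x2 _ t) _"]
    by (intro sum.cong refl nn_integral_cong inner)
  also have "\<dots> = (\<Sum>i<M1. \<Sum>j<M2. \<integral>\<^sup>+s. \<integral>\<^sup>+z. ennreal (?g j s / pdfS s) * ennreal (?u i s z) \<partial>gauss_vec n \<partial>lebesgue_vec n)"
    by (intro sum.cong refl GL.Fubini'[symmetric]) measurable
  also have "\<dots> = (\<Sum>i<M1. \<Sum>j<M2. \<integral>\<^sup>+s. ennreal (?g j s / pdfS s) * (\<integral>\<^sup>+z. ennreal (?u i s z) \<partial>gauss_vec n) \<partial>lebesgue_vec n)"
    by (intro sum.cong refl nn_integral_cong nn_integral_cmult) measurable
  \<comment> \<open>Message 1 has to become the inner sum: \<open>?u\<close> averages to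
    \<open>pdfS\<close> only over \<open>i\<close> and \<open>z\<close> together.\<close>
  also have "\<dots> = (\<Sum>j<M2. \<Sum>i<M1. \<integral>\<^sup>+s. ennreal (?g j s / pdfS s) * (\<integral>\<^sup>+z. ennreal (?u i s z) \<partial>gauss_vec n) \<partial>lebesgue_vec n)"
    by (rule sum.swap)
  also have "\<dots> = (\<Sum>j<M2. \<integral>\<^sup>+s. ennreal (?g j s / pdfS s) * (\<Sum>i<M1. \<integral>\<^sup>+z. ennreal (?u i s z) \<partial>gauss_vec n) \<partial>lebesgue_vec n)"
    unfolding sum_distrib_left by (intro sum.cong refl nn_integral_sum[symmetric]) measurable
  also have "\<dots> = (\<Sum>j<M2. \<integral>\<^sup>+s. of_nat M1 * ennreal (?g j s) \<partial>lebesgue_vec n)"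
  proof (intro sum.cong refl nn_integral_cong)
    fix j s
    have "ennreal (?g j s / pdfS s) * ennreal (pdfS s) = ennreal (?g j s)"
      using pdfS_pos[of s] by (simp add: ennreal_mult'[symmetric] gauss_pdf_nonneg less_imp_le)
    then show "ennreal (?g j s / pdfS s) * (\<Sum>i<M1. \<integral>\<^sup>+z. ennreal (?u i s z) \<partial>gauss_vec n) = of_nat M1 * ennreal (?g j s)"
      unfolding sum_nn_integral_pdfS by (simp add: mult.left_commute)
  qed
  also have "\<dots> = of_nat M1 * of_nat M2"
    using assms by (simp add: nn_integral_cmult nn_integral_gauss_pdf mult.commute)
  finally show ?thesis .
qed

text \<open>For a fixed message 3, dividing by \<open>pdfU\<close> cancels the law of the
  interference plus noise. In logarithms the mean of \<open>ln r\<close> is at most a Gaussian bound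
  on h(Y3), minus h(U).\<close>

lemma gibbs_receiver3:
  assumes [measurable]: "\<And>k. r k \<in> borel_measurable (PiM {..<n} (\<lambda>_. borel))"
    and r0: "\<And>k y. r k y \<ge> (0::real)"
    and r1: "\<And>y. (\<Sum>k<M3. r k y) \<le> real M3" and "\<gamma> > 0"
  shows "(\<Sum>j<M2. \<Sum>k<M3. \<integral>\<^sup>+w.
      (let u = vec_shift n (\<lambda>t. a2 * x2 j t) w; y = vec_shift n (x3 k) u in
        ennreal (r k y * gauss_pdf \<gamma> n (\<lambda>t. y t - \<mu> t) / pdfU u)) \<partial>gauss_vec n)
    \<le> of_nat M2 * of_nat M3"
proof -
  let ?f = "\<lambda>k y. r k y * gauss_pdf \<gamma> n (\<lambda>t. y t - \<mu> t)"
  have [measurable]: "?f k \<in> borel_measurable (PiM {..<n} (\<lambda>_. borel))" for k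
    by measurable
  have "(\<lambda>u. vec_shift n (x3 k) u) \<in> measurable (PiM {..<n} (\<lambda>_. borel)) (PiM {..<n} (\<lambda>_. borel))" for k
    by measurable
  from measurable_compose[OF this, of "?f _" borel]
  have [measurable]: "(\<lambda>u. ?f k (vec_shift n (x3 k) u)) \<in> borel_measurable (PiM {..<n} (\<lambda>_. borel))" for k
    by simp
  have [measurable]: "(\<lambda>u. pdfU u) \<in> borel_measurable (PiM {..<n} (\<lambda>_. borel))"
    by measurable
  have f0: "?f k y \<ge> 0" for k y using r0 by (simp add: gauss_pdf_nonneg)
  have "(\<Sum>j<M2. \<Sum>k<M3. \<integral>\<^sup>+w. (let u = vec_shift n (\<lambda>t. a2 * x2 j t) w; y = vec_shift n (x3 k) u in
        ennreal (?f k y / pdfU u)) \<partial>gauss_vec n)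
     = (\<Sum>k<M3. \<Sum>j<M2. \<integral>\<^sup>+w. (\<lambda>u. ennreal (?f k (vec_shift n (x3 k) u) / pdfU u)) (vec_shift n (\<lambda>t. a2 * x2 j t) w) \<partial>gauss_vec n)"
    unfolding Let_def by (rule sum.swap)
  also have "\<dots> = (\<Sum>k<M3. of_nat M2 * (\<integral>\<^sup>+u. ennreal (pdfU u) * ennreal (?f k (vec_shift n (x3 k) u) / pdfU u) \<partial>lebesgue_vec n))"
    by (intro sum.cong refl sum_nn_integral_pdfU) measurable
  also have "\<dots> = (\<Sum>k<M3. of_nat M2 * (\<integral>\<^sup>+u. ennreal (?f k (vec_shift n (x3 k) u)) \<partial>lebesgue_vec n))"
  proof (intro sum.cong refl arg_cong2[where f="(*)"] nn_integral_cong)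
    fix k u show "ennreal (pdfU u) * ennreal (?f k (vec_shift n (x3 k) u) / pdfU u) = ennreal (?f k (vec_shift n (x3 k) u))"
      using pdfU_pos[of u] f0 by (simp add: ennreal_mult'[symmetric] less_imp_le)
  qed
  \<comment> \<open>Translation by the codeword preserves Lebesgue measure, so all \<open>k\<close>
    now share the variable \<open>y\<close> and the weights can be added.\<close>
  also have "\<dots> = (\<Sum>k<M3. of_nat M2 * (\<integral>\<^sup>+y. ennreal (?f k y) \<partial>lebesgue_vec n))"
    by (intro sum.cong refl arg_cong2[where f="(*)"] nn_integral_vec_shift[where F="\<lambda>y. ennreal (?f _ y)"]) measurable
  also have "\<dots> = of_nat M2 * (\<integral>\<^sup>+y. (\<Sum>k<M3. ennreal (?f k y)) \<partial>lebesgue_vec n)"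
    by (simp add: nn_integral_sum sum_distrib_left)
  also have "\<dots> \<le> of_nat M2 * (\<integral>\<^sup>+y. of_nat M3 * ennreal (gauss_pdf \<gamma> n (\<lambda>t. y t - \<mu> t)) \<partial>lebesgue_vec n)"
  proof (intro mult_left_mono nn_integral_mono)
    fix y
    have "(\<Sum>k<M3. ennreal (?f k y)) = ennreal ((\<Sum>k<M3. r k y) * gauss_pdf \<gamma> n (\<lambda>t. y t - \<mu> t))"
      using f0 by (simp add: sum_ennreal sum_distrib_right)
    also have "\<dots> \<le> ennreal (real M3 * gauss_pdf \<gamma> n (\<lambda>t. y t - \<mu> t))"
      using r1 by (intro ennreal_leI mult_right_mono) (auto simp: gauss_pdf_nonneg)
    finally show "(\<Sum>k<M3. ennreal (?f k y)) \<le> of_nat M3 * ennreal (gauss_pdf \<gamma> n (\<lambda>t. y t - \<mu> t))"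
      by (simp add: ennreal_mult' ennreal_of_nat_eq_real_of_nat)
  qed simp
  also have "\<dots> = of_nat M2 * of_nat M3"
    using assms(4) by (simp add: nn_integral_cmult nn_integral_gauss_pdf)
  finally show ?thesis .
qed

end

section \<open>Summing the logarithmic inequalities before integration\<close>

lemma
  fixes c :: "nat \<Rightarrow> real" and \<alpha> \<beta> v :: real
  assumes v: "v > 0" and h: "\<And>p t. t < n \<Longrightarrow> h p t = c t + \<alpha> * fst p t + \<beta> * snd p t"
  shows integrable_ln_gauss_pdf: "integrable (gauss_vec n \<Otimes>\<^sub>M gauss_vec n) (\<lambda>p. ln (gauss_pdf v n (h p)))"
    and integral_ln_gauss_pdf: "(\<integral>p. ln (gauss_pdf v n (h p)) \<partial>(gauss_vec n \<Otimes>\<^sub>M gauss_vec n))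
      = - (real n / 2) * ln (2 * pi * v) - ((\<Sum>t<n. (c t)\<^sup>2) + real n * (\<alpha>\<^sup>2 + \<beta>\<^sup>2)) / (2 * v)"
proof -
  let ?P = "gauss_vec n \<Otimes>\<^sub>M gauss_vec n"
  interpret G: prob_space "gauss_vec n" by (rule prob_space_gauss_vec)
  interpret P: pair_prob_space "gauss_vec n" "gauss_vec n" ..
  have eq: "ln (gauss_pdf v n (h p)) = - (real n / 2) * ln (2 * pi * v)
      - (\<Sum>t<n. (c t + \<alpha> * fst p t + \<beta> * snd p t)\<^sup>2) / (2 * v)" for p
    unfolding ln_gauss_pdf[OF v] by (simp add: h)
  have I: "integrable ?P (\<lambda>p. \<Sum>t<n. (c t + \<alpha> * fst p t + \<beta> * snd p t)\<^sup>2)"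
    by (intro Bochner_Integration.integrable_sum integrable_gauss_pair_square) simp
  show "integrable ?P (\<lambda>p. ln (gauss_pdf v n (h p)))"
    unfolding eq using I by (intro Bochner_Integration.integrable_diff P.integrable_const integrable_divide_zero) simp
  have "(\<integral>p. (\<Sum>t<n. (c t + \<alpha> * fst p t + \<beta> * snd p t)\<^sup>2) \<partial>?P) = (\<Sum>t<n. (c t)\<^sup>2 + \<alpha>\<^sup>2 + \<beta>\<^sup>2)"
    by (subst Bochner_Integration.integral_sum)
       (auto intro!: sum.cong integrable_gauss_pair_square simp: integral_gauss_pair_square)
  also have "\<dots> = (\<Sum>t<n. (c t)\<^sup>2) + real n * (\<alpha>\<^sup>2 + \<beta>\<^sup>2)"
    by (simp add: sum.distrib algebra_simps)
  finally have E: "(\<integral>p. (\<Sum>t<n. (c t + \<alpha> * fst p t + \<beta> * snd p t)\<^sup>2) \<partial>?P) = \<dots>" .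
  show "(\<integral>p. ln (gauss_pdf v n (h p)) \<partial>?P)
      = - (real n / 2) * ln (2 * pi * v) - ((\<Sum>t<n. (c t)\<^sup>2) + real n * (\<alpha>\<^sup>2 + \<beta>\<^sup>2)) / (2 * v)"
    unfolding eq using I by (simp add: E P.prob_space del: sum_divide_distrib)
qed

text \<open>In the application \<open>F\<close> is a sum of \<open>K\<close> positive ratios and
  \<open>T\<close> is minus the sum of their logarithms, so \<open>le\<close> is ln e \<le> e - 1
  added up. Integrability of \<open>F\<close> comes from the bound itself; only \<open>T\<close>
  must be integrable beforehand.\<close>

lemma sum_integral_nonneg_of_exponential_bound:
  fixes T F :: "'c \<Rightarrow> 'a \<Rightarrow> real" and K :: real
  assumes P: "prob_space P" and I: "finite I" and K: "K \<ge> 0"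
    and T: "\<And>c. c \<in> I \<Longrightarrow> integrable P (T c)"
    and F: "\<And>c. c \<in> I \<Longrightarrow> F c \<in> borel_measurable P" and F0: "\<And>c p. F c p \<ge> 0"
    and le: "\<And>c p. c \<in> I \<Longrightarrow> K - T c p \<le> F c p"
    and bound: "(\<Sum>c\<in>I. \<integral>\<^sup>+p. ennreal (F c p) \<partial>P) \<le> ennreal (K * real (card I))"
  shows "0 \<le> (\<Sum>c\<in>I. integral\<^sup>L P (T c))"
proof -
  interpret prob_space P by fact
  have fin: "(\<integral>\<^sup>+p. ennreal (F c p) \<partial>P) < \<infinity>" if "c \<in> I" for c
  proof -
    have "(\<integral>\<^sup>+p. ennreal (F c p) \<partial>P) \<le> (\<Sum>c\<in>I. \<integral>\<^sup>+p. ennreal (F c p) \<partial>P)"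
      using that I by (intro member_le_sum) auto
    also have "\<dots> \<le> ennreal (K * real (card I))" by (rule bound)
    finally show ?thesis by (simp add: le_less_trans)
  qed
  have int: "integrable P (F c)" if "c \<in> I" for c
    using F[OF that] fin[OF that] F0 by (intro integrableI_nonneg) auto
  have "(\<Sum>c\<in>I. \<integral>\<^sup>+p. ennreal (F c p) \<partial>P) = (\<Sum>c\<in>I. ennreal (integral\<^sup>L P (F c)))"
    using F0 by (intro sum.cong refl nn_integral_eq_integral int) auto
  also have "\<dots> = ennreal (\<Sum>c\<in>I. integral\<^sup>L P (F c))"
    using F0 by (intro sum_ennreal integral_nonneg_AE) auto
  finally have "ennreal (\<Sum>c\<in>I. integral\<^sup>L P (F c)) \<le> ennreal (K * real (card I))"
    using bound by simp
  then have up: "(\<Sum>c\<in>I. integral\<^sup>L P (F c)) \<le> K * real (card I)"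
    using K by (simp add: ennreal_le_iff)
  have "K - integral\<^sup>L P (T c) \<le> integral\<^sup>L P (F c)" if "c \<in> I" for c
  proof -
    have "K - integral\<^sup>L P (T c) = (\<integral>p. K - T c p \<partial>P)"
      using T[OF that] by (simp add: prob_space)
    also have "\<dots> \<le> integral\<^sup>L P (F c)"
      using T[OF that] int[OF that] le[OF that] by (intro integral_mono) auto
    finally show ?thesis .
  qed
  then have "(\<Sum>c\<in>I. K - integral\<^sup>L P (T c)) \<le> (\<Sum>c\<in>I. integral\<^sup>L P (F c))"
    by (rule sum_mono)
  with up show ?thesis by (simp add: sum_subtractf mult.commute)
qed

lemma sum_triple:
  "(\<Sum>c\<in>{..<M1::nat} \<times> {..<M2::nat} \<times> {..<M3::nat}. f (fst c) (fst (snd c)) (snd (snd c)))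
    = (\<Sum>i<M1. \<Sum>j<M2. \<Sum>k<M3. f i j k)"
  by (simp add: sum.cartesian_product case_prod_unfold)

context codebooks
begin

lemma integrable_ln_bounded:
  assumes [measurable]: "r \<in> borel_measurable (PiM {..<n} (\<lambda>_. borel))"
    and "b > 0" "\<And>y. b \<le> r y" "\<And>y. r y \<le> (B::real)"
  shows "integrable (gauss_vec n) (\<lambda>z. ln (r (vec_shift n c z)))"
proof (rule G.integrable_const_bound[where B="max \<bar>ln b\<bar> \<bar>ln B\<bar>"])
  have "\<bar>ln (r y)\<bar> \<le> max \<bar>ln b\<bar> \<bar>ln B\<bar>" for y
  proof -
    have "ln b \<le> ln (r y)" "ln (r y) \<le> ln B"
      using assms(2) assms(3)[of y] assms(4)[of y] by auto
    then show ?thesis by auto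
  qed
  then show "AE z in gauss_vec n. norm (ln (r (vec_shift n c z))) \<le> max \<bar>ln b\<bar> \<bar>ln B\<bar>"
    by simp
qed measurable

text \<open>
  The weights \<open>r12\<close> and \<open>r3\<close> are posterior guesses of the messages, relative to the uniform prior.
  The coefficient \<open>\<alpha>\<close> is that of the linear estimate of \<open>V\<close> from \<open>S\<close>.
\<close>

lemma decoding_bound:
  fixes r12 :: "nat \<Rightarrow> nat \<Rightarrow> (nat \<Rightarrow> real) \<Rightarrow> real" and r3 :: "nat \<Rightarrow> (nat \<Rightarrow> real) \<Rightarrow> real"
  assumes m12[measurable]: "\<And>i j. r12 i j \<in> borel_measurable (PiM {..<n} (\<lambda>_. borel))"
    and m3[measurable]: "\<And>k. r3 k \<in> borel_measurable (PiM {..<n} (\<lambda>_. borel))"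
    and b: "b > 0" and r12: "\<And>i j y. b \<le> r12 i j y" "\<And>i j y. r12 i j y \<le> B"
    and r3: "\<And>k y. b \<le> r3 k y" "\<And>k y. r3 k y \<le> B"
    and s12: "\<And>y. (\<Sum>i<M1. \<Sum>j<M2. r12 i j y) \<le> real M1 * real M2"
    and s3: "\<And>y. (\<Sum>k<M3. r3 k y) \<le> real M3"
    and pos: "\<kappa> > 0" "\<psi> > 0" "\<gamma> > 0"
    and pw\<kappa>: "(\<Sum>i<M1. \<Sum>j<M2. \<Sum>k<M3. \<Sum>t<n. ((1 - \<alpha> * a2) * (a1 * x1 i t + x2 j t) - \<mu> t)\<^sup>2)
        \<le> real M1 * real M2 * real M3 * (real n * (\<kappa> - (1 - \<alpha> * a2)\<^sup>2 - \<alpha>\<^sup>2))"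
    and pw\<psi>: "(\<Sum>i<M1. \<Sum>j<M2. \<Sum>k<M3. \<Sum>t<n. (a2 * a1 * x1 i t - \<nu> t)\<^sup>2)
        \<le> real M1 * real M2 * real M3 * (real n * (\<psi> - a2\<^sup>2 - 1))"
    and pw\<gamma>: "(\<Sum>i<M1. \<Sum>j<M2. \<Sum>k<M3. \<Sum>t<n. (x3 k t + a2 * x2 j t - \<xi> t)\<^sup>2)
        \<le> real M1 * real M2 * real M3 * (real n * (\<gamma> - 1))"
  shows "(\<Sum>i<M1. \<Sum>j<M2. \<Sum>k<M3.
        (\<integral>z. ln (r12 i j (vec_shift n (\<lambda>t. a1 * x1 i t + x2 j t) z)) \<partial>gauss_vec n)
      + (\<integral>w. ln (r3 k (vec_shift n (\<lambda>t. x3 k t + a2 * x2 j t) w)) \<partial>gauss_vec n))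
    \<le> real M1 * real M2 * real M3 * (real n / 2 * (ln \<kappa> + ln \<psi> + ln \<gamma>))"
proof -
  let ?G = "gauss_vec n" and ?P = "gauss_vec n \<Otimes>\<^sub>M gauss_vec n"
  interpret P: pair_prob_space ?G ?G ..
  note pg = prob_space_gauss_vec[of n]
  define V where "V i j z = vec_shift n (\<lambda>t. a1 * x1 i t + x2 j t) z" for i j z
  define S where "S i j z w = vec_shift n (\<lambda>t. a2 * V i j z t) w" for i j z w
  define U where "U j w = vec_shift n (\<lambda>t. a2 * x2 j t) w" for j w
  define Y where "Y j k w = vec_shift n (x3 k) (U j w)" for j k w
  \<comment> \<open>Two forms of the third output are needed: through \<open>U\<close> for
    \<open>gibbs_receiver3\<close>, and as a single shift for the decoding weights.\<close>
  have Y: "Y j k w = vec_shift n (\<lambda>t. x3 k t + a2 * x2 j t) w" for j k w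
    unfolding Y_def U_def vec_shift_def by auto
  have mV[measurable]: "(\<lambda>p. V i j (fst p)) \<in> measurable ?P (PiM {..<n} (\<lambda>_. borel))" for i j
    unfolding V_def by measurable
  have mV': "(\<lambda>z. V i j z) \<in> measurable ?G (PiM {..<n} (\<lambda>_. borel))" for i j
    unfolding V_def by measurable
  have Vt: "V i j z t = a1 * x1 i t + x2 j t + z t" if "t < n" for i j z t
    using that by (simp add: V_def vec_shift_def)
  have St: "S i j z w t = a2 * (a1 * x1 i t + x2 j t + z t) + w t" if "t < n" for i j z w t
    using that by (simp add: S_def vec_shift_def Vt)
  have Ut: "U j w t = a2 * x2 j t + w t" if "t < n" for j w t
    using that by (simp add: U_def vec_shift_def)
  have Yt: "Y j k w t = x3 k t + (a2 * x2 j t + w t)" if "t < n" for j k w t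
    using that by (simp add: Y_def vec_shift_def Ut)
  have mS[measurable]: "(\<lambda>p. S i j (fst p) (snd p)) \<in> measurable ?P (PiM {..<n} (\<lambda>_. borel))" for i j
    unfolding S_def by (intro measurable_vec_shift) (simp_all add: Vt)
  have mU[measurable]: "(\<lambda>p. U j (snd p)) \<in> measurable ?P (PiM {..<n} (\<lambda>_. borel))" for j
    unfolding U_def by measurable
  have mY[measurable]: "(\<lambda>p. Y j k (snd p)) \<in> measurable ?P (PiM {..<n} (\<lambda>_. borel))" for j k
    unfolding Y by measurable
  define g1 g2 g3 where
      "g1 i j z w = gauss_pdf \<kappa> n (\<lambda>t. V i j z t - (\<alpha> * S i j z w t + \<mu> t))"
    and "g2 i j z w = gauss_pdf \<psi> n (\<lambda>t. S i j z w t - (a2 * x2 j t + \<nu> t))"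
    and "g3 j k w = gauss_pdf \<gamma> n (\<lambda>t. Y j k w t - \<xi> t)" for i j k z w
  have g_pos: "g1 i j z w > 0" "g2 i j z w > 0" "g3 j k w > 0" for i j k z w
    unfolding g1_def g2_def g3_def using pos by (simp_all add: gauss_pdf_pos)
  have mg[measurable]: "(\<lambda>p. g1 i j (fst p) (snd p)) \<in> borel_measurable ?P"
      "(\<lambda>p. g2 i j (fst p) (snd p)) \<in> borel_measurable ?P"
      "(\<lambda>p. g3 j k (snd p)) \<in> borel_measurable ?P" for i j k
    unfolding g1_def g2_def g3_def
    by (intro measurable_gauss_pdf; simp add: Vt St Yt)+
  define e1 e2 e3 e4 where
      "e1 i j z = r12 i j (V i j z) * pdfV (V i j z) / gauss_pdf 1 n z"
    and "e2 i j z w = pdfS (S i j z w) * g1 i j z w / (pdfV (V i j z) * gauss_pdf 1 n w)"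
    and "e3 i j z w = g2 i j z w * pdfU (\<lambda>t. S i j z w t - a2 * (a1 * x1 i t + z t)) / (pdfS (S i j z w) * gauss_pdf 1 n w)"
    and "e4 j k w = r3 k (Y j k w) * g3 j k w / pdfU (U j w)" for i j k z w
  have r_pos: "r12 i j y > 0" "r3 k y > 0" for i j k y
    using b r12(1)[of i j y] r3(1)[of k y] by linarith+
  note ps = r_pos g_pos pdfV_pos pdfU_pos pdfS_pos gauss_pdf_pos[of 1 n]
  have e_pos: "e1 i j z > 0" "e2 i j z w > 0" "e3 i j z w > 0" "e4 j k w > 0" for i j k z w
    unfolding e1_def e2_def e3_def e4_def by (intro divide_pos_pos mult_pos_pos ps; simp)+
  have me1[measurable]: "(\<lambda>p. e1 i j (fst p)) \<in> borel_measurable ?P" for i j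
    unfolding e1_def by (intro borel_measurable_divide borel_measurable_times measurable_compose[OF mV m12] measurable_pdfV measurable_gauss_pdf) (simp_all add: Vt)
  have me2[measurable]: "(\<lambda>p. e2 i j (fst p) (snd p)) \<in> borel_measurable ?P" for i j
    unfolding e2_def by (intro borel_measurable_divide borel_measurable_times measurable_compose[OF mS measurable_pdfS] mg measurable_pdfV measurable_gauss_pdf) (simp_all add: Vt)
  have me3[measurable]: "(\<lambda>p. e3 i j (fst p) (snd p)) \<in> borel_measurable ?P" for i j
    unfolding e3_def by (intro borel_measurable_divide borel_measurable_times measurable_compose[OF mS measurable_pdfS] mg measurable_pdfU measurable_gauss_pdf) (simp_all add: St)
  have me4[measurable]: "(\<lambda>p. e4 j k (snd p)) \<in> borel_measurable ?P" for j k
    unfolding e4_def by (intro borel_measurable_divide borel_measurable_times measurable_compose[OF mY m3] mg measurable_pdfU) (simp_all add: Ut)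
  have me1'[measurable]: "(\<lambda>z. e1 i j z) \<in> borel_measurable ?G" for i j
    unfolding e1_def
    by (intro borel_measurable_divide borel_measurable_times measurable_compose[OF mV' m12] measurable_pdfV measurable_gauss_pdf)
       (simp_all add: Vt measurable_gauss_vec_component)
  \<comment> \<open>Minus the logarithm of the product of the four ratios after cancellation. The
    factor 2 appears because both \<open>e2\<close> and \<open>e3\<close> divide by the density of
    \<open>w\<close>.\<close>
  define T where "T i j k p = ln (gauss_pdf 1 n (fst p)) + 2 * ln (gauss_pdf 1 n (snd p))
      - ln (g1 i j (fst p) (snd p)) - ln (g2 i j (fst p) (snd p)) - ln (g3 j k (snd p))
      - ln (r12 i j (V i j (fst p))) - ln (r3 k (Y j k (snd p)))" for i j k p
  define F where "F i j k p = e1 i j (fst p) + e2 i j (fst p) (snd p) + e3 i j (fst p) (snd p) + e4 j k (snd p)" for i j k p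
  have le: "4 - T i j k p \<le> F i j k p" for i j k p
  proof -
    obtain z w where p: "p = (z, w)" by (cases p)
    \<comment> \<open>The shared noise \<open>w\<close> enters here: removing a2 (a1 X1 + Z2) from S
      gives exactly U, so the \<open>pdfU\<close> factors of \<open>e3\<close> and \<open>e4\<close>
      cancel pointwise.\<close>
    have u: "pdfU (\<lambda>t. S i j z w t - a2 * (a1 * x1 i t + z t)) = pdfU (U j w)"
      by (rule pdfU_cong) (simp add: St Ut algebra_simps)
    have "ln (e1 i j z) = ln (r12 i j (V i j z)) + ln (pdfV (V i j z)) - ln (gauss_pdf 1 n z)"
      unfolding e1_def by (simp add: ln_div ln_mult ps less_imp_neq[symmetric])
    moreover have "ln (e2 i j z w) = ln (pdfS (S i j z w)) + ln (g1 i j z w) - ln (pdfV (V i j z)) - ln (gauss_pdf 1 n w)"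
      unfolding e2_def by (simp add: ln_div ln_mult ps less_imp_neq[symmetric])
    moreover have "ln (e3 i j z w) = ln (g2 i j z w) + ln (pdfU (U j w)) - ln (pdfS (S i j z w)) - ln (gauss_pdf 1 n w)"
      unfolding e3_def u by (simp add: ln_div ln_mult ps less_imp_neq[symmetric])
    moreover have "ln (e4 j k w) = ln (r3 k (Y j k w)) + ln (g3 j k w) - ln (pdfU (U j w))"
      unfolding e4_def by (simp add: ln_div ln_mult ps less_imp_neq[symmetric])
    ultimately have "- T i j k p = ln (e1 i j z) + ln (e2 i j z w) + ln (e3 i j z w) + ln (e4 j k w)"
      unfolding T_def p by simp
    moreover have "ln (e1 i j z) \<le> e1 i j z - 1" "ln (e2 i j z w) \<le> e2 i j z w - 1"
      "ln (e3 i j z w) \<le> e3 i j z w - 1" "ln (e4 j k w) \<le> e4 j k w - 1"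
      by (intro ln_le_minus_one e_pos)+
    ultimately show ?thesis unfolding F_def p by simp
  qed
  have i12: "integrable ?G (\<lambda>z. ln (r12 i j (V i j z)))" for i j
    unfolding V_def by (rule integrable_ln_bounded[OF m12 b r12])
  have i3: "integrable ?G (\<lambda>w. ln (r3 k (Y j k w)))" for j k
    unfolding Y by (rule integrable_ln_bounded[OF m3 b r3])
  let ?c1 = "\<lambda>i j t. (1 - \<alpha> * a2) * (a1 * x1 i t + x2 j t) - \<mu> t"
  let ?c2 = "\<lambda>i t. a2 * a1 * x1 i t - \<nu> t"
  let ?c3 = "\<lambda>j k t. x3 k t + a2 * x2 j t - \<xi> t"
  have h1: "t < n \<Longrightarrow> V i j (fst p) t - (\<alpha> * S i j (fst p) (snd p) t + \<mu> t)
      = ?c1 i j t + (1 - \<alpha> * a2) * fst p t + (- \<alpha>) * snd p t" for i j p t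
    by (simp add: Vt St algebra_simps)
  have h2: "t < n \<Longrightarrow> S i j (fst p) (snd p) t - (a2 * x2 j t + \<nu> t)
      = ?c2 i t + a2 * fst p t + 1 * snd p t" for i j p t
    by (simp add: St algebra_simps)
  have h3: "t < n \<Longrightarrow> Y j k (snd p) t - \<xi> t = ?c3 j k t + 0 * fst p t + 1 * snd p t" for j k p t
    by (simp add: Yt algebra_simps)
  have h4: "t < n \<Longrightarrow> fst p t = 0 + 1 * fst p t + 0 * snd p t"
    and h5: "t < n \<Longrightarrow> snd p t = 0 + 0 * fst p t + 1 * snd p t" for p :: "(nat \<Rightarrow> real) \<times> (nat \<Rightarrow> real)" and t
    by simp_all
  have I1: "integrable ?P (\<lambda>p. ln (g1 i j (fst p) (snd p)))"
    and I2: "integrable ?P (\<lambda>p. ln (g2 i j (fst p) (snd p)))"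
    and I3: "integrable ?P (\<lambda>p. ln (g3 j k (snd p)))" for i j k
    unfolding g1_def g2_def g3_def
    by (rule integrable_ln_gauss_pdf[OF pos(1)], erule h1)
       (rule integrable_ln_gauss_pdf[OF pos(2)], erule h2,
        rule integrable_ln_gauss_pdf[OF pos(3)], erule h3)
  have I4: "integrable ?P (\<lambda>p. ln (gauss_pdf 1 n (fst p)))"
    and I5: "integrable ?P (\<lambda>p. ln (gauss_pdf 1 n (snd p)))"
    by (rule integrable_ln_gauss_pdf[OF zero_less_one], erule h4)
       (rule integrable_ln_gauss_pdf[OF zero_less_one], erule h5)
  have E1: "(\<integral>p. ln (g1 i j (fst p) (snd p)) \<partial>?P) = - (real n / 2) * ln (2 * pi * \<kappa>)
      - ((\<Sum>t<n. (?c1 i j t)\<^sup>2) + real n * ((1 - \<alpha> * a2)\<^sup>2 + (- \<alpha>)\<^sup>2)) / (2 * \<kappa>)"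
    and E2: "(\<integral>p. ln (g2 i j (fst p) (snd p)) \<partial>?P) = - (real n / 2) * ln (2 * pi * \<psi>)
      - ((\<Sum>t<n. (?c2 i t)\<^sup>2) + real n * (a2\<^sup>2 + 1\<^sup>2)) / (2 * \<psi>)"
    and E3: "(\<integral>p. ln (g3 j k (snd p)) \<partial>?P) = - (real n / 2) * ln (2 * pi * \<gamma>)
      - ((\<Sum>t<n. (?c3 j k t)\<^sup>2) + real n * (0\<^sup>2 + 1\<^sup>2)) / (2 * \<gamma>)" for i j k
    unfolding g1_def g2_def g3_def
    by (rule integral_ln_gauss_pdf[OF pos(1)], erule h1)
       (rule integral_ln_gauss_pdf[OF pos(2)], erule h2,
        rule integral_ln_gauss_pdf[OF pos(3)], erule h3)
  have E4: "(\<integral>p. ln (gauss_pdf 1 n (fst p)) \<partial>?P) = - (real n / 2) * ln (2 * pi * 1)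
      - ((\<Sum>t<n. 0\<^sup>2) + real n * (1\<^sup>2 + 0\<^sup>2)) / (2 * 1)"
    and E5: "(\<integral>p. ln (gauss_pdf 1 n (snd p)) \<partial>?P) = - (real n / 2) * ln (2 * pi * 1)
      - ((\<Sum>t<n. 0\<^sup>2) + real n * (0\<^sup>2 + 1\<^sup>2)) / (2 * 1)"
    by (rule integral_ln_gauss_pdf[OF zero_less_one], erule h4)
       (rule integral_ln_gauss_pdf[OF zero_less_one], erule h5)
  note I6 = integrable_pair_fst[OF pg pg i12] and I7 = integrable_pair_snd[OF pg pg i3]
  note E6 = integral_pair_fst[OF pg pg i12] and E7 = integral_pair_snd[OF pg pg i3]
  have IT: "integrable ?P (T i j k)" for i j k
    unfolding T_def by (intro Bochner_Integration.integrable_diff Bochner_Integration.integrable_add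
        integrable_mult_right I1 I2 I3 I4 I5 I6 I7)
  let ?R = "\<lambda>i j k. (\<integral>z. ln (r12 i j (V i j z)) \<partial>?G) + (\<integral>w. ln (r3 k (Y j k w)) \<partial>?G)"
  \<comment> \<open>The three unit Gaussian factors contribute \<open>- real n / 2 * 3\<close>
    through their mean exponents; their \<open>ln (2 * pi)\<close> terms cancel against those of
    \<open>g1\<close>, \<open>g2\<close> and \<open>g3\<close>.\<close>
  let ?Q = "\<lambda>i j k. real n / 2 * (ln \<kappa> + ln \<psi> + ln \<gamma>) - real n / 2 * 3
      + ((\<Sum>t<n. (?c1 i j t)\<^sup>2) + real n * ((1 - \<alpha> * a2)\<^sup>2 + \<alpha>\<^sup>2)) / (2 * \<kappa>)
      + ((\<Sum>t<n. (?c2 i t)\<^sup>2) + real n * (a2\<^sup>2 + 1)) / (2 * \<psi>)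
      + ((\<Sum>t<n. (?c3 j k t)\<^sup>2) + real n) / (2 * \<gamma>)"
  have ET: "integral\<^sup>L ?P (T i j k) = ?Q i j k - ?R i j k" for i j k
  proof -
    have "integral\<^sup>L ?P (T i j k) = (\<integral>p. ln (gauss_pdf 1 n (fst p)) \<partial>?P) + 2 * (\<integral>p. ln (gauss_pdf 1 n (snd p)) \<partial>?P)
      - (\<integral>p. ln (g1 i j (fst p) (snd p)) \<partial>?P) - (\<integral>p. ln (g2 i j (fst p) (snd p)) \<partial>?P) - (\<integral>p. ln (g3 j k (snd p)) \<partial>?P)
      - (\<integral>p. ln (r12 i j (V i j (fst p))) \<partial>?P) - (\<integral>p. ln (r3 k (Y j k (snd p))) \<partial>?P)"
      unfolding T_def by (simp add: I1 I2 I3 I4 I5 I6 I7)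
    also have "\<dots> = ?Q i j k - ?R i j k"
      unfolding E1 E2 E3 E6 E7 using pos
      by (simp add: E4 E5 ln_mult field_simps)
    finally show ?thesis .
  qed
  let ?I = "{..<M1} \<times> {..<M2} \<times> {..<M3}"
  let ?M = "real M1 * real M2 * real M3"
  have "0 \<le> (\<Sum>c\<in>?I. integral\<^sup>L ?P (T (fst c) (fst (snd c)) (snd (snd c))))"
  \<comment> \<open>\<open>K = 4\<close>: one unit for each of the four ratios, whose averages are
    at most 1.\<close>
  proof (rule sum_integral_nonneg_of_exponential_bound[where K=4 and F="\<lambda>c. F (fst c) (fst (snd c)) (snd (snd c))"])
    show "prob_space ?P" by (rule P.prob_space_axioms)
    show "F (fst c) (fst (snd c)) (snd (snd c)) \<in> borel_measurable ?P" for c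
      unfolding F_def by measurable
    show "F (fst c) (fst (snd c)) (snd (snd c)) p \<ge> 0" for c p
      unfolding F_def by (intro add_nonneg_nonneg less_imp_le e_pos)
    have *: "(\<integral>\<^sup>+p. ennreal (F i j k p) \<partial>?P) = (\<integral>\<^sup>+z. ennreal (e1 i j z) \<partial>?G)
        + (\<integral>\<^sup>+z. \<integral>\<^sup>+w. ennreal (e2 i j z w) \<partial>?G \<partial>?G) + (\<integral>\<^sup>+z. \<integral>\<^sup>+w. ennreal (e3 i j z w) \<partial>?G \<partial>?G)
        + (\<integral>\<^sup>+w. ennreal (e4 j k w) \<partial>?G)" for i j k
    proof -
      have "(\<integral>\<^sup>+p. ennreal (F i j k p) \<partial>?P) = (\<integral>\<^sup>+p. ennreal (e1 i j (fst p)) + ennreal (e2 i j (fst p) (snd p))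
          + ennreal (e3 i j (fst p) (snd p)) + ennreal (e4 j k (snd p)) \<partial>?P)"
        unfolding F_def using e_pos by (simp add: ennreal_plus less_imp_le add_nonneg_nonneg)
      also have "\<dots> = (\<integral>\<^sup>+p. ennreal (e1 i j (fst p)) \<partial>?P) + (\<integral>\<^sup>+p. ennreal (e2 i j (fst p) (snd p)) \<partial>?P)
          + (\<integral>\<^sup>+p. ennreal (e3 i j (fst p) (snd p)) \<partial>?P) + (\<integral>\<^sup>+p. ennreal (e4 j k (snd p)) \<partial>?P)"
        by (simp add: nn_integral_add)
      also have "(\<integral>\<^sup>+p. ennreal (e1 i j (fst p)) \<partial>?P) = (\<integral>\<^sup>+z. ennreal (e1 i j z) \<partial>?G)"
        by (subst G.nn_integral_fst[symmetric]) (simp_all add: G.emeasure_space_1)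
      also have "(\<integral>\<^sup>+p. ennreal (e2 i j (fst p) (snd p)) \<partial>?P) = (\<integral>\<^sup>+z. \<integral>\<^sup>+w. ennreal (e2 i j z w) \<partial>?G \<partial>?G)"
        by (subst G.nn_integral_fst[symmetric]) simp_all
      also have "(\<integral>\<^sup>+p. ennreal (e3 i j (fst p) (snd p)) \<partial>?P) = (\<integral>\<^sup>+z. \<integral>\<^sup>+w. ennreal (e3 i j z w) \<partial>?G \<partial>?G)"
        by (subst G.nn_integral_fst[symmetric]) simp_all
      also have "(\<integral>\<^sup>+p. ennreal (e4 j k (snd p)) \<partial>?P) = (\<integral>\<^sup>+w. ennreal (e4 j k w) \<partial>?G)"
        by (subst G.nn_integral_fst[symmetric]) (simp_all add: G.emeasure_space_1)
      finally show ?thesis .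
    qed
    have A1: "(\<Sum>i<M1. \<Sum>j<M2. \<integral>\<^sup>+z. ennreal (e1 i j z) \<partial>?G) \<le> of_nat M1 * of_nat M2"
      using gibbs_receiver2[of r12] r_pos s12 unfolding e1_def V_def by (simp add: less_imp_le)
    have A2: "(\<Sum>i<M1. \<Sum>j<M2. \<integral>\<^sup>+z. \<integral>\<^sup>+w. ennreal (e2 i j z w) \<partial>?G \<partial>?G) = of_nat M1 * of_nat M2"
      using gibbs_estimation[OF pos(1), of \<alpha> \<mu>] unfolding e2_def g1_def S_def V_def Let_def .
    have A3: "(\<Sum>i<M1. \<Sum>j<M2. \<integral>\<^sup>+z. \<integral>\<^sup>+w. ennreal (e3 i j z w) \<partial>?G \<partial>?G) = of_nat M1 * of_nat M2"
      using gibbs_data_processing[OF pos(2), of \<nu>] unfolding e3_def g2_def S_def V_def Let_def .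
    have A4: "(\<Sum>j<M2. \<Sum>k<M3. \<integral>\<^sup>+w. ennreal (e4 j k w) \<partial>?G) \<le> of_nat M2 * of_nat M3"
      using gibbs_receiver3[OF m3 _ s3 pos(3), of \<xi>] r_pos unfolding e4_def g3_def Y_def U_def Let_def
      by (simp add: less_imp_le)
    have "(\<Sum>c\<in>?I. \<integral>\<^sup>+p. ennreal (F (fst c) (fst (snd c)) (snd (snd c)) p) \<partial>?P)
        = (\<Sum>i<M1. \<Sum>j<M2. \<Sum>k<M3. \<integral>\<^sup>+p. ennreal (F i j k p) \<partial>?P)"
      by (rule sum_triple)
    \<comment> \<open>\<open>e1\<close>, \<open>e2\<close> and \<open>e3\<close> do not depend on
      message 3, and \<open>e4\<close> does not depend on message 1; the idle sums give the factors
      \<open>M3\<close> and \<open>M1\<close>.\<close>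
    also have "\<dots> = of_nat M3 * (\<Sum>i<M1. \<Sum>j<M2. \<integral>\<^sup>+z. ennreal (e1 i j z) \<partial>?G)
        + of_nat M3 * (\<Sum>i<M1. \<Sum>j<M2. \<integral>\<^sup>+z. \<integral>\<^sup>+w. ennreal (e2 i j z w) \<partial>?G \<partial>?G)
        + of_nat M3 * (\<Sum>i<M1. \<Sum>j<M2. \<integral>\<^sup>+z. \<integral>\<^sup>+w. ennreal (e3 i j z w) \<partial>?G \<partial>?G)
        + of_nat M1 * (\<Sum>j<M2. \<Sum>k<M3. \<integral>\<^sup>+w. ennreal (e4 j k w) \<partial>?G)"
      unfolding * sum.distrib sum_constant sum_distrib_left[symmetric] card_lessThan ..
    also have "\<dots> \<le> of_nat M3 * (of_nat M1 * of_nat M2) + of_nat M3 * (of_nat M1 * of_nat M2)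
        + of_nat M3 * (of_nat M1 * of_nat M2) + of_nat M1 * (of_nat M2 * of_nat M3)"
      unfolding A2 A3 by (intro add_mono mult_left_mono A1 A4) auto
    also have "\<dots> = of_nat (M3 * (M1 * M2) + M3 * (M1 * M2) + M3 * (M1 * M2) + M1 * (M2 * M3))"
      by (simp only: of_nat_add of_nat_mult)
    also have "M3 * (M1 * M2) + M3 * (M1 * M2) + M3 * (M1 * M2) + M1 * (M2 * M3) = 4 * card ?I"
      by (simp add: card_cartesian_product)
    also have "of_nat (4 * card ?I) = ennreal (4 * real (card ?I))"
      unfolding ennreal_of_nat_eq_real_of_nat by simp
    finally show "(\<Sum>c\<in>?I. \<integral>\<^sup>+p. ennreal (F (fst c) (fst (snd c)) (snd (snd c)) p) \<partial>?P)
        \<le> ennreal (4 * real (card ?I))" .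
  qed (auto simp: IT le)
  also have "\<dots> = (\<Sum>i<M1. \<Sum>j<M2. \<Sum>k<M3. integral\<^sup>L ?P (T i j k))"
    by (rule sum_triple)
  also have "\<dots> = (\<Sum>i<M1. \<Sum>j<M2. \<Sum>k<M3. ?Q i j k) - (\<Sum>i<M1. \<Sum>j<M2. \<Sum>k<M3. ?R i j k)"
    unfolding ET by (simp only: sum_subtractf)
  finally have RQ: "(\<Sum>i<M1. \<Sum>j<M2. \<Sum>k<M3. ?R i j k) \<le> (\<Sum>i<M1. \<Sum>j<M2. \<Sum>k<M3. ?Q i j k)"
    by simp
  let ?C1 = "\<Sum>i<M1. \<Sum>j<M2. \<Sum>k<M3. \<Sum>t<n. (?c1 i j t)\<^sup>2"
  let ?C2 = "\<Sum>i<M1. \<Sum>j<M2. \<Sum>k<M3. \<Sum>t<n. (?c2 i t)\<^sup>2"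
  let ?C3 = "\<Sum>i<M1. \<Sum>j<M2. \<Sum>k<M3. \<Sum>t<n. (?c3 j k t)\<^sup>2"
  have sc: "(\<Sum>i<M1. \<Sum>j<M2. \<Sum>k<M3. (f i j k + d) / e) = ((\<Sum>i<M1. \<Sum>j<M2. \<Sum>k<M3. f i j k) + ?M * d) / e"
    for f :: "nat \<Rightarrow> nat \<Rightarrow> nat \<Rightarrow> real" and d e
    by (simp add: sum_divide_distrib[symmetric] sum.distrib mult.assoc)
  have "(\<Sum>i<M1. \<Sum>j<M2. \<Sum>k<M3. ?Q i j k) = ?M * (real n / 2 * (ln \<kappa> + ln \<psi> + ln \<gamma>) - real n / 2 * 3)
      + (?C1 + ?M * (real n * ((1 - \<alpha> * a2)\<^sup>2 + \<alpha>\<^sup>2))) / (2 * \<kappa>)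
      + (?C2 + ?M * (real n * (a2\<^sup>2 + 1))) / (2 * \<psi>)
      + (?C3 + ?M * real n) / (2 * \<gamma>)"
    unfolding sum.distrib sc by (simp only: sum_constant card_lessThan mult.assoc)
  \<comment> \<open>The power hypotheses are shaped so that signal plus noise in each numerator is
    at most \<open>real n\<close> times the reference variance. Each fraction is then at most
    \<open>?M * real n / 2\<close>, and the three absorb the term
    \<open>real n / 2 * 3\<close>.\<close>
  also have "\<dots> \<le> ?M * (real n / 2 * (ln \<kappa> + ln \<psi> + ln \<gamma>) - real n / 2 * 3)
      + (?M * real n * \<kappa>) / (2 * \<kappa>) + (?M * real n * \<psi>) / (2 * \<psi>) + (?M * real n * \<gamma>) / (2 * \<gamma>)"
    using pos pw\<kappa> pw\<psi> pw\<gamma>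
    by (intro add_mono order_refl divide_right_mono) (simp_all add: algebra_simps)
  also have "\<dots> = ?M * (real n / 2 * (ln \<kappa> + ln \<psi> + ln \<gamma>))"
    using pos by (simp add: field_simps)
  finally show ?thesis
    using RQ unfolding V_def Y by linarith
qed

end

section \<open>Fano weights and power constraints\<close>

text \<open>The weight is an equal mixture of a uniform guess and the decoder's guess, relative to
  the uniform prior. The uniform half keeps its logarithm bounded below and costs
  \<open>ln 2\<close>, the constant in Fano's inequality. The bound is convexity of
  \<open>exp\<close> between 0 and \<open>ln M\<close>.\<close>

lemma ln_fano_weight:
  fixes p M :: real
  assumes "0 \<le> p" "p \<le> 1" "M \<ge> 1"
  shows "p * ln M - ln 2 \<le> ln (1 / 2 + M / 2 * p)"
proof -
  have "exp ((1 - p) * 0 + p * ln M) \<le> (1 - p) * exp 0 + p * exp (ln M)"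
    using convex_onD[OF exp_convex, of p 0 "ln M"] assms by simp
  then have "exp (p * ln M) \<le> 1 + M * p"
    using assms by (simp add: algebra_simps)
  then have "p * ln M \<le> ln (1 + M * p)"
    using assms by (subst ln_ge_iff) (auto intro: add_pos_nonneg)
  also have "1 + M * p = 2 * (1 / 2 + M / 2 * p)"
    by simp
  also have "ln \<dots> = ln 2 + ln (1 / 2 + M / 2 * p)"
    using assms by (intro ln_mult_pos) (auto intro!: add_pos_nonneg)
  finally show ?thesis by simp
qed

text \<open>Centring makes the cross terms cancel over the product of the two codebooks, and it can
  only lower the second moments.\<close>

lemma sum_centered_square_le:
  fixes f g :: "nat \<Rightarrow> real"
  assumes "M \<ge> 1" "N \<ge> 1"
  shows "(\<Sum>i<M. \<Sum>j<N. (b * (f i - (\<Sum>i<M. f i) / real M) + c * (g j - (\<Sum>j<N. g j) / real N))\<^sup>2)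
    \<le> real N * b\<^sup>2 * (\<Sum>i<M. (f i)\<^sup>2) + real M * c\<^sup>2 * (\<Sum>j<N. (g j)\<^sup>2)"
proof -
  have zero: "(\<Sum>i<K. h i - (\<Sum>i<K. h i) / real K) = 0"
    and sq: "(\<Sum>i<K. (h i - (\<Sum>i<K. h i) / real K)\<^sup>2) \<le> (\<Sum>i<K. (h i)\<^sup>2)"
    if "K \<ge> 1" for K and h :: "nat \<Rightarrow> real"
  proof -
    define m where "m = (\<Sum>i<K. h i) / real K"
    have m: "(\<Sum>i<K. h i) = real K * m"
      using that by (simp add: m_def)
    show "(\<Sum>i<K. h i - (\<Sum>i<K. h i) / real K) = 0"
      unfolding m_def[symmetric] by (simp add: sum_subtractf m)
    have "(\<Sum>i<K. (h i - m)\<^sup>2) = (\<Sum>i<K. (h i)\<^sup>2) - 2 * m * (\<Sum>i<K. h i) + real K * m\<^sup>2"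
      by (simp add: power2_diff sum.distrib sum_subtractf sum_distrib_left algebra_simps)
    also have "\<dots> \<le> (\<Sum>i<K. (h i)\<^sup>2)"
      using mult_nonneg_nonneg[of "real K" "m\<^sup>2"] unfolding m by (simp add: power2_eq_square algebra_simps)
    finally show "(\<Sum>i<K. (h i - (\<Sum>i<K. h i) / real K)\<^sup>2) \<le> (\<Sum>i<K. (h i)\<^sup>2)"
      unfolding m_def .
  qed
  define F where "F i = f i - (\<Sum>i<M. f i) / real M" for i
  define H where "H j = g j - (\<Sum>j<N. g j) / real N" for j
  have "(\<Sum>i<M. \<Sum>j<N. (b * F i + c * H j)\<^sup>2)
      = (\<Sum>i<M. \<Sum>j<N. b\<^sup>2 * (F i)\<^sup>2 + c\<^sup>2 * (H j)\<^sup>2 + (2 * b * c * F i) * H j)"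
    by (simp add: power2_eq_square algebra_simps)
  also have "\<dots> = real N * b\<^sup>2 * (\<Sum>i<M. (F i)\<^sup>2) + real M * c\<^sup>2 * (\<Sum>j<N. (H j)\<^sup>2)"
    using zero[OF assms(2), of g]
    by (simp add: sum.distrib sum_distrib_left[symmetric] H_def[symmetric] mult.assoc)
  also have "\<dots> \<le> real N * b\<^sup>2 * (\<Sum>i<M. (f i)\<^sup>2) + real M * c\<^sup>2 * (\<Sum>j<N. (g j)\<^sup>2)"
    unfolding F_def H_def by (intro add_mono mult_left_mono sq assms) auto
  finally show ?thesis unfolding F_def H_def .
qed

lemma sum_centered_power_le:
  fixes f g :: "nat \<Rightarrow> nat \<Rightarrow> real"
  assumes "M \<ge> 1" "N \<ge> 1"
    and f: "\<And>i. i < M \<Longrightarrow> (\<Sum>t<n. (f i t)\<^sup>2) \<le> real n * P"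
    and g: "\<And>j. j < N \<Longrightarrow> (\<Sum>t<n. (g j t)\<^sup>2) \<le> real n * Q"
  shows "(\<Sum>i<M. \<Sum>j<N. \<Sum>t<n. (b * f i t + c * g j t - (b * ((\<Sum>i<M. f i t) / real M) + c * ((\<Sum>j<N. g j t) / real N)))\<^sup>2)
    \<le> real M * real N * (real n * (b\<^sup>2 * P + c\<^sup>2 * Q))"
proof -
  have "(\<Sum>i<M. \<Sum>j<N. \<Sum>t<n. (b * f i t + c * g j t - (b * ((\<Sum>i<M. f i t) / real M) + c * ((\<Sum>j<N. g j t) / real N)))\<^sup>2)
    = (\<Sum>i<M. \<Sum>j<N. \<Sum>t<n. (b * (f i t - (\<Sum>i<M. f i t) / real M) + c * (g j t - (\<Sum>j<N. g j t) / real N))\<^sup>2)"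
    by (intro sum.cong refl arg_cong[where f="\<lambda>x. x\<^sup>2"]) (simp add: algebra_simps)
  also have "\<dots> = (\<Sum>t<n. \<Sum>i<M. \<Sum>j<N. (b * (f i t - (\<Sum>i<M. f i t) / real M) + c * (g j t - (\<Sum>j<N. g j t) / real N))\<^sup>2)"
    by (subst sum.swap[of _ "{..<n}"], intro sum.cong refl sum.swap)
  also have "\<dots> \<le> (\<Sum>t<n. real N * b\<^sup>2 * (\<Sum>i<M. (f i t)\<^sup>2) + real M * c\<^sup>2 * (\<Sum>j<N. (g j t)\<^sup>2))"
    by (intro sum_mono sum_centered_square_le assms)
  also have "\<dots> = real N * b\<^sup>2 * (\<Sum>i<M. \<Sum>t<n. (f i t)\<^sup>2) + real M * c\<^sup>2 * (\<Sum>j<N. \<Sum>t<n. (g j t)\<^sup>2)"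
    unfolding sum.distrib sum_distrib_left[symmetric] sum.swap[of _ _ "{..<n}"] ..
  also have "\<dots> \<le> real N * b\<^sup>2 * (\<Sum>i<M. real n * P) + real M * c\<^sup>2 * (\<Sum>j<N. real n * Q)"
    by (intro add_mono mult_left_mono sum_mono f g) auto
  also have "\<dots> = real M * real N * (real n * (b\<^sup>2 * P + c\<^sup>2 * Q))"
    by (simp add: algebra_simps)
  finally show ?thesis .
qed

section \<open>Decoder indicators and the average error probability\<close>

definition hit :: "((nat \<Rightarrow> real) \<Rightarrow> nat) \<Rightarrow> nat \<Rightarrow> (nat \<Rightarrow> real) \<Rightarrow> real" where
  "hit d m y = of_bool (d y = m)"

lemma hit_bounds: "0 \<le> hit d m y" "hit d m y \<le> 1"
  by (simp_all add: hit_def)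

lemma sum_hit_le: "(\<Sum>m<M. hit d m y) \<le> 1"
proof -
  have "(\<Sum>m<M. hit d m y) = (\<Sum>m<M. if m = d y then 1 else 0)"
    unfolding hit_def by (intro sum.cong) auto
  also have "\<dots> \<le> 1" by (simp add: sum.delta)
  finally show ?thesis .
qed

lemma measurable_hit:
  assumes [measurable]: "d \<in> measurable (PiM {..<n} (\<lambda>_. borel)) (count_space UNIV)"
  shows "hit d m \<in> borel_measurable (PiM {..<n} (\<lambda>_. borel))"
  unfolding hit_def by measurable

lemma prob_space_noise_measure: "prob_space (noise_measure n)"
  unfolding noise_measure_def by (intro prob_space_PiM prob_space_std_normal)

lemma measurable_noise_component:
  assumes "u < 3" "t < n"
  shows "(\<lambda>z. z (u, t)) \<in> borel_measurable (noise_measure n)"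
proof -
  have "(\<lambda>z. z (u, t)) \<in> measurable (noise_measure n) std_normal"
    unfolding noise_measure_def using assms by (intro measurable_component_singleton) auto
  then show ?thesis by simp
qed

text \<open>A receiver sees only its own row of the noise array, so its success probability depends
  on one Gaussian vector alone. This justifies later choosing the noise of receiver 1 as a function
  of other noise.\<close>

lemma expectation_hit_noise:
  assumes d: "d \<in> measurable (PiM {..<n} (\<lambda>_. borel)) (count_space UNIV)" and u: "u < 3"
  shows "measure (noise_measure n) {z \<in> space (noise_measure n). d (vec_shift n c (\<lambda>t. z (u, t))) \<noteq> m}
    = 1 - (\<integral>w. hit d m (vec_shift n c w) \<partial>gauss_vec n)"
proof -
  let ?N = "noise_measure n"
  interpret N: prob_space ?N by (rule prob_space_noise_measure)
  note d[measurable]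
  let ?h = "\<lambda>z. \<lambda>t\<in>{..<n}. z (u, t)"
  have mh: "?h \<in> measurable ?N (gauss_vec n)"
    unfolding measurable_cong_sets[OF refl sets_gauss_vec]
    using u by (intro measurable_restrict measurable_noise_component) auto
  have sh: "vec_shift n c (?h z) = vec_shift n c (\<lambda>t. z (u, t))" for z
    by (auto simp: vec_shift_def)
  have ms: "(\<lambda>z. vec_shift n c (\<lambda>t. z (u, t))) \<in> measurable ?N (PiM {..<n} (\<lambda>_. borel))"
    using u by (intro measurable_vec_shift measurable_noise_component) auto
  have hm: "(\<lambda>w. hit d m (vec_shift n c w)) \<in> borel_measurable (gauss_vec n)"
    by (rule measurable_compose[OF _ measurable_hit[OF d]]) measurable
  let ?A = "{z \<in> space ?N. d (vec_shift n c (\<lambda>t. z (u, t))) = m}"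
  have A: "?A \<in> sets ?N"
    using measurable_sets[OF measurable_compose[OF ms d], of "{m}"] by (simp add: vimage_def Int_def conj_commute)
  have "(\<integral>w. hit d m (vec_shift n c w) \<partial>gauss_vec n) = (\<integral>w. hit d m (vec_shift n c w) \<partial>distr ?N (gauss_vec n) ?h)"
    by (simp add: distr_noise_measure_user[OF u])
  also have "\<dots> = (\<integral>z. hit d m (vec_shift n c (?h z)) \<partial>?N)"
    by (rule integral_distr[OF mh hm])
  also have "\<dots> = (\<integral>z. indicator ?A z \<partial>?N)"
    unfolding sh by (intro Bochner_Integration.integral_cong) (auto simp: hit_def indicator_def)
  also have "\<dots> = N.prob ?A"
    using A by simp
  finally have "1 - (\<integral>w. hit d m (vec_shift n c w) \<partial>gauss_vec n) = 1 - N.prob ?A" by simp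
  also have "\<dots> = N.prob (space ?N - ?A)"
    using A by (simp add: N.prob_compl)
  also have "space ?N - ?A = {z \<in> space ?N. d (vec_shift n c (\<lambda>t. z (u, t))) \<noteq> m}"
    by auto
  finally show ?thesis by simp
qed

text \<open>Message vectors are functions on all of \<open>nat\<close>, pinned to 0 from index 3 on,
  so they correspond bijectively to triples.\<close>

lemma sum_messages:
  fixes f :: "(nat \<Rightarrow> nat) \<Rightarrow> real"
  shows "(\<Sum>m\<in>{m. \<forall>i<3. m i < M i} \<inter> {m. \<forall>i\<ge>3. m i = 0}. f m)
    = (\<Sum>i<M 0. \<Sum>j<M 1. \<Sum>k<M 2. f ((\<lambda>_. 0)(0 := i, 1 := j, 2 := k)))"
proof -
  have lt3: "u < 3 \<longleftrightarrow> u = 0 \<or> u = 1 \<or> u = 2" for u :: nat by auto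
  have ext: "(\<lambda>_. 0)(0 := m 0, 1 := m 1, 2 := m 2) = m" if "\<forall>u\<ge>3. m u = 0" for m :: "nat \<Rightarrow> nat"
  proof
    fix u show "((\<lambda>_. 0)(0 := m 0, 1 := m 1, 2 := m 2)) u = m u"
      using that lt3[of u] by (cases "u < 3") auto
  qed
  have "(\<Sum>m\<in>{m. \<forall>i<3. m i < M i} \<inter> {m. \<forall>i\<ge>3. m i = 0}. f m)
    = (\<Sum>c\<in>{..<M 0} \<times> {..<M 1} \<times> {..<M 2}. f ((\<lambda>_. 0)(0 := fst c, 1 := fst (snd c), 2 := snd (snd c))))"
    by (rule sum.reindex_bij_witness[where i="\<lambda>c. (\<lambda>_. 0)(0 := fst c, 1 := fst (snd c), 2 := snd (snd c))"
          and j="\<lambda>m. (m 0, m 1, m 2)"])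
       (use ext in \<open>auto simp: lt3\<close>)
  also have "\<dots> = (\<Sum>i<M 0. \<Sum>j<M 1. \<Sum>k<M 2. f ((\<lambda>_. 0)(0 := i, 1 := j, 2 := k)))"
    by (rule sum_triple)
  finally show ?thesis .
qed

text \<open>The error event of a single receiver is contained in the joint error event, so each
  receiver separately succeeds with average probability at least
  \<open>1 - \<epsilon>\<close>.\<close>

lemma sum_hit_ge:
  assumes code: "is_code P1 P2 P3 n M x d" and err: "err_prob a1 a2 n M x d \<le> \<epsilon>"
  shows "(1 - \<epsilon>) * (real (M 0) * real (M 1) * real (M 2))
      \<le> (\<Sum>i<M 0. \<Sum>j<M 1. \<Sum>k<M 2. \<integral>w. hit (d 0) i (vec_shift n (x 0 i) w) \<partial>gauss_vec n)" (is ?t1)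
    and "(1 - \<epsilon>) * (real (M 0) * real (M 1) * real (M 2))
      \<le> (\<Sum>i<M 0. \<Sum>j<M 1. \<Sum>k<M 2. \<integral>w. hit (d 1) j (vec_shift n (\<lambda>t. a1 * x 0 i t + x 1 j t) w) \<partial>gauss_vec n)" (is ?t2)
    and "(1 - \<epsilon>) * (real (M 0) * real (M 1) * real (M 2))
      \<le> (\<Sum>i<M 0. \<Sum>j<M 1. \<Sum>k<M 2. \<integral>w. hit (d 2) k (vec_shift n (\<lambda>t. x 2 k t + a2 * x 1 j t) w) \<partial>gauss_vec n)" (is ?t3)
proof -
  let ?N = "noise_measure n"
  interpret N: prob_space ?N by (rule prob_space_noise_measure)
  define msg :: "nat \<Rightarrow> nat \<Rightarrow> nat \<Rightarrow> nat \<Rightarrow> nat" where "msg i j k = (\<lambda>_. 0)(0 := i, 1 := j, 2 := k)" for i j k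
  define C where "C u i j k = (if u = 0 then x 0 i else if u = 1 then (\<lambda>t. a1 * x 0 i t + x 1 j t)
      else (\<lambda>t. x 2 k t + a2 * x 1 j t))" for u i j k :: nat
  let ?M = "real (M 0) * real (M 1) * real (M 2)"
  have M: "M 0 \<ge> 1" "M 1 \<ge> 1" "M 2 \<ge> 1"
    and d: "\<And>u. u < 3 \<Longrightarrow> d u \<in> measurable (PiM {..<n} (\<lambda>_. borel)) (count_space UNIV)"
    using code unfolding is_code_def by auto
  have rx: "rx a1 a2 n x (msg i j k) z u = vec_shift n (C u i j k) (\<lambda>t. z (u, t))" if "u < 3" for i j k z u
  proof -
    have "u = 0 \<or> u = 1 \<or> u = 2" using that by linarith
    then show ?thesis
      by (elim disjE) (auto simp: rx_def vec_shift_def C_def msg_def fun_eq_iff)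
  qed
  have meas: "{z \<in> space ?N. d u (rx a1 a2 n x (msg i j k) z u) \<noteq> msg i j k u} \<in> sets ?N" if "u < 3" for u i j k
  proof -
    have "(\<lambda>z. vec_shift n (C u i j k) (\<lambda>t. z (u, t))) \<in> measurable ?N (PiM {..<n} (\<lambda>_. borel))"
      using that by (intro measurable_vec_shift measurable_noise_component) auto
    from measurable_sets[OF measurable_compose[OF this d[OF that]], of "- {msg i j k u}"]
    show ?thesis unfolding rx[OF that] by (simp add: vimage_def Int_def conj_commute)
  qed
  have main: "(1 - \<epsilon>) * ?M \<le> (\<Sum>i<M 0. \<Sum>j<M 1. \<Sum>k<M 2. \<integral>w. hit (d u) (msg i j k u) (vec_shift n (C u i j k) w) \<partial>gauss_vec n)"
    if u: "u < 3" for u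
  proof -
    let ?E = "\<lambda>i j k. {z \<in> space ?N. \<exists>u<3. d u (rx a1 a2 n x (msg i j k) z u) \<noteq> msg i j k u}"
    have E: "?E i j k \<in> sets ?N" for i j k
    proof -
      have "?E i j k = (\<Union>u\<in>{..<3}. {z \<in> space ?N. d u (rx a1 a2 n x (msg i j k) z u) \<noteq> msg i j k u})"
        by auto
      also have "\<dots> \<in> sets ?N" using meas by (intro sets.finite_UN) auto
      finally show ?thesis .
    qed
    have "1 - (\<integral>w. hit (d u) (msg i j k u) (vec_shift n (C u i j k) w) \<partial>gauss_vec n) \<le> N.prob (?E i j k)" for i j k
    proof -
      have "1 - (\<integral>w. hit (d u) (msg i j k u) (vec_shift n (C u i j k) w) \<partial>gauss_vec n)
        = N.prob {z \<in> space ?N. d u (rx a1 a2 n x (msg i j k) z u) \<noteq> msg i j k u}"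
        unfolding rx[OF u] by (rule expectation_hit_noise[OF d[OF u] u, symmetric])
      also have "\<dots> \<le> N.prob (?E i j k)"
        using u by (intro N.finite_measure_mono E) auto
      finally show ?thesis .
    qed
    then have "(\<Sum>i<M 0. \<Sum>j<M 1. \<Sum>k<M 2. 1 - (\<integral>w. hit (d u) (msg i j k u) (vec_shift n (C u i j k) w) \<partial>gauss_vec n))
      \<le> (\<Sum>i<M 0. \<Sum>j<M 1. \<Sum>k<M 2. N.prob (?E i j k))"
      by (intro sum_mono)
    also have "\<dots> = err_prob a1 a2 n M x d * ?M"
      unfolding err_prob_def sum_messages msg_def using M by simp
    also have "\<dots> \<le> \<epsilon> * ?M"
      by (intro mult_right_mono err) simp
    finally show ?thesis
      by (simp add: sum_subtractf algebra_simps)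
  qed
  show ?t1 using main[of 0] by (simp add: C_def msg_def)
  show ?t2 using main[of 1] by (simp add: C_def msg_def)
  show ?t3 using main[of 2] by (simp add: C_def msg_def)
qed

section \<open>Converse bound at a fixed block length\<close>

text \<open>Each of the weights \<open>r1\<close>, \<open>r2\<close>, \<open>r3\<close> costs one
  \<open>ln 2\<close>. The arguments of the logarithms on the right are the variances of the three
  Gaussian references: the estimation error of V from S, S given X2, and Y3.\<close>

lemma code_bound:
  assumes code: "is_code P1 P2 P3 n M x d" and err: "err_prob a1 a2 n M x d \<le> \<epsilon>"
    and a1: "a1 \<ge> 1" and P: "P1 \<ge> 0" "P2 \<ge> 0" "P3 \<ge> 0"
    and p: "p = 1 + a1\<^sup>2 * P1 + P2"
  shows "(1 - \<epsilon>) * (ln (real (M 0)) + ln (real (M 1)) + ln (real (M 2))) - 3 * ln 2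
    \<le> real n / 2 * (ln (p / (1 + a2\<^sup>2 * p)) + ln (1 + a2\<^sup>2 * (1 + a1\<^sup>2 * P1)) + ln (1 + a2\<^sup>2 * P2 + P3))"
proof -
  have M: "M 0 \<ge> 1" "M 1 \<ge> 1" "M 2 \<ge> 1"
    and d: "d 0 \<in> measurable (PiM {..<n} (\<lambda>_. borel)) (count_space UNIV)"
      "d 1 \<in> measurable (PiM {..<n} (\<lambda>_. borel)) (count_space UNIV)"
      "d 2 \<in> measurable (PiM {..<n} (\<lambda>_. borel)) (count_space UNIV)"
    and pw: "\<And>i. i < M 0 \<Longrightarrow> (\<Sum>t<n. (x 0 i t)\<^sup>2) \<le> real n * P1"
      "\<And>i. i < M 1 \<Longrightarrow> (\<Sum>t<n. (x 1 i t)\<^sup>2) \<le> real n * P2"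
      "\<And>i. i < M 2 \<Longrightarrow> (\<Sum>t<n. (x 2 i t)\<^sup>2) \<le> real n * P3"
    using code[unfolded is_code_def, THEN conjunct1]
      code[unfolded is_code_def, THEN conjunct2, THEN conjunct2]
      code[unfolded is_code_def, THEN conjunct2, THEN conjunct1, rule_format, of 0]
      code[unfolded is_code_def, THEN conjunct2, THEN conjunct1, rule_format, of 1]
      code[unfolded is_code_def, THEN conjunct2, THEN conjunct1, rule_format, of 2]
    by auto
  interpret C: codebooks a1 a2 n "M 0" "M 1" "M 2" "x 0" "x 1" "x 2"
    by standard (rule M)+
  let ?G = "gauss_vec n" and ?P = "gauss_vec n \<Otimes>\<^sub>M gauss_vec n"
  interpret PP: pair_prob_space ?G ?G ..
  note hm = measurable_hit[OF d(1)] measurable_hit[OF d(2)] measurable_hit[OF d(3)]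
  \<comment> \<open>Given message 2, \<open>deg\<close> turns the output of receiver 2 into one distributed like that of receiver 1.\<close>
  define \<beta> where "\<beta> = sqrt (1 - 1 / a1\<^sup>2)"
  have \<beta>: "\<beta> \<ge> 0" "(1 / a1)\<^sup>2 + \<beta>\<^sup>2 = 1"
    using a1 by (simp_all add: \<beta>_def power_divide)
  define deg where "deg j y z' = (\<lambda>t\<in>{..<n}. (y t - x 1 j t) / a1 + \<beta> * z' t)" for j y z'
  \<comment> \<open>Averaging over the fresh noise leaves a function of the output of receiver 2
    alone, as a posterior weight must be. It is conditional on message 2, whose codeword
    \<open>deg\<close> subtracts.\<close>
  define p1 where "p1 i j y = (\<integral>z'. hit (d 0) i (deg j y z') \<partial>?G)" for i j y
  define r1 where "r1 i j y = 1 / 2 + real (M 0) / 2 * p1 i j y" for i j y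
  define r2 where "r2 j y = 1 / 2 + real (M 1) / 2 * hit (d 1) j y" for j y
  define r3 where "r3 k y = 1 / 2 + real (M 2) / 2 * hit (d 2) k y" for k y
  have mdeg: "(\<lambda>q. deg j (fst q) (snd q)) \<in> measurable (PiM {..<n} (\<lambda>_. borel) \<Otimes>\<^sub>M ?G) (PiM {..<n} (\<lambda>_. borel))" for j
    unfolding deg_def by measurable
  have mhd: "(\<lambda>q. hit (d 0) i (deg j (fst q) (snd q))) \<in> borel_measurable (PiM {..<n} (\<lambda>_. borel) \<Otimes>\<^sub>M ?G)" for i j
    by (rule measurable_compose[OF mdeg hm(1)])
  have mp1: "p1 i j \<in> borel_measurable (PiM {..<n} (\<lambda>_. borel))" for i j
    unfolding p1_def
    by (rule C.G.borel_measurable_lebesgue_integral) (use mhd in \<open>simp add: case_prod_unfold\<close>)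
  have ihd: "integrable ?G (\<lambda>z'. hit (d 0) i (deg j y z'))" for i j y
  proof (rule C.G.integrable_const_bound[where B=1])
    have "deg j y \<in> measurable ?G (PiM {..<n} (\<lambda>_. borel))"
      unfolding deg_def by measurable
    from measurable_compose[OF this hm(1)]
    show "(\<lambda>z'. hit (d 0) i (deg j y z')) \<in> borel_measurable ?G" .
  qed (simp add: hit_def)
  have p1: "0 \<le> p1 i j y" "p1 i j y \<le> 1" for i j y
  proof -
    show "0 \<le> p1 i j y" unfolding p1_def by (intro integral_nonneg_AE AE_I2) (simp add: hit_def)
    have "p1 i j y \<le> (\<integral>z'. 1 \<partial>?G)"
      unfolding p1_def by (intro integral_mono ihd) (simp_all add: hit_def)
    then show "p1 i j y \<le> 1" by (simp add: C.G.prob_space)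
  qed
  have sp1: "(\<Sum>i<M 0. p1 i j y) \<le> 1" for j y
  proof -
    have "(\<Sum>i<M 0. p1 i j y) = (\<integral>z'. (\<Sum>i<M 0. hit (d 0) i (deg j y z')) \<partial>?G)"
      unfolding p1_def by (rule Bochner_Integration.integral_sum[symmetric]) (rule ihd)
    also have "\<dots> \<le> (\<integral>z'. 1 \<partial>?G)"
      by (intro integral_mono Bochner_Integration.integrable_sum ihd sum_hit_le) simp
    finally show ?thesis by (simp add: C.G.prob_space)
  qed
  have ws: "(\<Sum>i<m. 1 / 2 + real m / 2 * h i) \<le> real m" if "(\<Sum>i<m. h i) \<le> 1" for m and h :: "nat \<Rightarrow> real"
    using mult_left_mono[OF that, of "real m / 2"] unfolding sum.distrib sum_distrib_left[symmetric] by simp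
  have s1: "(\<Sum>i<M 0. r1 i j y) \<le> real (M 0)" for j y
    unfolding r1_def by (rule ws[OF sp1])
  have s2: "(\<Sum>j<M 1. r2 j y) \<le> real (M 1)" for y
    unfolding r2_def by (rule ws[OF sum_hit_le])
  have s3: "(\<Sum>k<M 2. r3 k y) \<le> real (M 2)" for y
    unfolding r3_def by (rule ws[OF sum_hit_le])
  have weight: "1 / 2 \<le> 1 / 2 + real m / 2 * h \<and> 1 / 2 + real m / 2 * h \<le> 1 + real m"
    if "0 \<le> h" "h \<le> 1" for m h
    using that mult_left_mono[of h 1 "real m / 2"] by simp
  have b1: "1 / 2 \<le> r1 i j y" "r1 i j y \<le> 1 + real (M 0)" for i j y
    using weight[OF p1] unfolding r1_def by auto
  have b2: "1 / 2 \<le> r2 j y" "r2 j y \<le> 1 + real (M 1)" for j y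
    using weight[OF hit_bounds] unfolding r2_def by auto
  have b3: "1 / 2 \<le> r3 k y" "r3 k y \<le> 1 + real (M 2)" for k y
    using weight[OF hit_bounds] unfolding r3_def by auto
  \<comment> \<open>Chain rule for guesses: \<open>r2\<close> guesses message 2 from the output, and
    \<open>r1\<close> guesses message 1 given message 2.\<close>
  define r12 where "r12 i j y = r1 i j y * r2 j y" for i j y
  have b12: "1 / 4 \<le> r12 i j y" "r12 i j y \<le> (1 + real (M 0)) * (1 + real (M 1))" for i j y
    unfolding r12_def using b1[of i j y] b2[of j y] mult_mono[of "1/2" "r1 i j y" "1/2" "r2 j y"]
      mult_mono[of "r1 i j y" "1 + real (M 0)" "r2 j y" "1 + real (M 1)"] by auto
  define B where "B = max ((1 + real (M 0)) * (1 + real (M 1))) (1 + real (M 2))"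
  have b12': "r12 i j y \<le> B" and b3': "1 / 4 \<le> r3 k y" "r3 k y \<le> B" for i j k y
    using b12(2)[of i j y] b3[of k y] unfolding B_def by auto
  have mr12: "r12 i j \<in> borel_measurable (PiM {..<n} (\<lambda>_. borel))" for i j
    unfolding r12_def r1_def r2_def
    by (intro borel_measurable_times borel_measurable_add borel_measurable_const mp1 hm)
  have mr3: "r3 k \<in> borel_measurable (PiM {..<n} (\<lambda>_. borel))" for k
    unfolding r3_def
    by (intro borel_measurable_times borel_measurable_add borel_measurable_const hm)
  have s12: "(\<Sum>i<M 0. \<Sum>j<M 1. r12 i j y) \<le> real (M 0) * real (M 1)" for y
  proof -
    \<comment> \<open>Message 1 is summed first because \<open>r1\<close> is normalised separately
      for every \<open>j\<close>.\<close>
    have "(\<Sum>i<M 0. \<Sum>j<M 1. r12 i j y) = (\<Sum>j<M 1. \<Sum>i<M 0. r12 i j y)"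
      by (rule sum.swap)
    also have "\<dots> = (\<Sum>j<M 1. (\<Sum>i<M 0. r1 i j y) * r2 j y)"
      by (simp add: r12_def sum_distrib_right)
    also have "\<dots> \<le> (\<Sum>j<M 1. real (M 0) * r2 j y)"
    proof (intro sum_mono mult_right_mono s1)
      fix j show "0 \<le> r2 j y" using b2(1)[of j y] by simp
    qed
    also have "\<dots> \<le> real (M 0) * real (M 1)"
      using s2[of y] by (simp add: sum_distrib_left[symmetric] mult_left_mono)
    finally show ?thesis .
  qed

  \<comment> \<open>\<open>\<kappa>\<close> is the error of the optimal linear estimate when \<open>V\<close> has power \<open>p\<close> per symbol.\<close>
  define D where "D = 1 + a2\<^sup>2 * p"
  define \<alpha> where "\<alpha> = a2 * p / D"
  define \<kappa> where "\<kappa> = p / D"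
  have a1P1: "a1\<^sup>2 * P1 \<ge> 0" using P by simp
  have p_pos: "p > 0" unfolding p using P a1P1 by linarith
  have D_pos: "D > 0" unfolding D_def using p_pos by (intro add_pos_nonneg) auto
  have \<alpha>a2: "1 - \<alpha> * a2 = 1 / D"
    using D_pos unfolding \<alpha>_def by (simp add: field_simps D_def power2_eq_square)
  \<comment> \<open>The optimal error is (1 - \<alpha> a2)^2 p + \<alpha>^2. Removing the
    contributions of Z2 and Z3 leaves precisely the signal power that \<open>decoding_bound\<close>
    allows for the centred codewords.\<close>
  have \<kappa>_eq: "\<kappa> - (1 - \<alpha> * a2)\<^sup>2 - \<alpha>\<^sup>2 = ((1 - \<alpha> * a2) * a1)\<^sup>2 * P1 + (1 - \<alpha> * a2)\<^sup>2 * P2"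
  proof -
    have "\<kappa> = p * D / D\<^sup>2" unfolding \<kappa>_def using D_pos by (simp add: power2_eq_square)
    also have "\<dots> = (1 / D)\<^sup>2 * p + \<alpha>\<^sup>2"
      unfolding \<alpha>_def by (simp add: D_def power_divide power2_eq_square add_divide_distrib[symmetric] algebra_simps)
    finally show ?thesis unfolding \<alpha>a2 p by (simp add: power_mult_distrib power_divide algebra_simps)
  qed
  \<comment> \<open>The reference centres are built from these codebook means, so that
    \<open>sum_centered_power_le\<close> applies without assuming centred codebooks.\<close>
  define mean where "mean u t = (\<Sum>i<M u. x u i t) / real (M u)" for u t
  let ?M = "real (M 0) * real (M 1) * real (M 2)"

  have upper: "(\<Sum>i<M 0. \<Sum>j<M 1. \<Sum>k<M 2.
        (\<integral>z. ln (r12 i j (vec_shift n (\<lambda>t. a1 * x 0 i t + x 1 j t) z)) \<partial>?G)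
      + (\<integral>w. ln (r3 k (vec_shift n (\<lambda>t. x 2 k t + a2 * x 1 j t) w)) \<partial>?G))
    \<le> ?M * (real n / 2 * (ln \<kappa> + ln (1 + a2\<^sup>2 * (1 + a1\<^sup>2 * P1)) + ln (1 + a2\<^sup>2 * P2 + P3)))"
  proof (rule C.decoding_bound[OF mr12 mr3 _ b12(1) b12' b3' s12 s3, where \<alpha>=\<alpha>
        and \<mu>="\<lambda>t. (1 - \<alpha> * a2) * a1 * mean 0 t + (1 - \<alpha> * a2) * mean 1 t"
        and \<nu>="\<lambda>t. a2 * a1 * mean 0 t" and \<xi>="\<lambda>t. a2 * mean 1 t + mean 2 t"])
    show "0 < \<kappa>" unfolding \<kappa>_def using p_pos D_pos by simp
    show "0 < 1 + a2\<^sup>2 * (1 + a1\<^sup>2 * P1)" using a1P1 by (intro add_pos_nonneg) auto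
    show "0 < 1 + a2\<^sup>2 * P2 + P3" using P by (intro add_pos_nonneg) auto
    have "(\<Sum>i<M 0. \<Sum>j<M 1. \<Sum>t<n. ((1 - \<alpha> * a2) * (a1 * x 0 i t + x 1 j t) - ((1 - \<alpha> * a2) * a1 * mean 0 t + (1 - \<alpha> * a2) * mean 1 t))\<^sup>2)
      \<le> real (M 0) * real (M 1) * (real n * (((1 - \<alpha> * a2) * a1)\<^sup>2 * P1 + (1 - \<alpha> * a2)\<^sup>2 * P2))"
      using sum_centered_power_le[where f="x 0" and g="x 1" and b="(1 - \<alpha> * a2) * a1" and c="1 - \<alpha> * a2", OF M(1) M(2) pw(1) pw(2)]
      unfolding mean_def[symmetric] by (simp add: distrib_left mult.assoc)
    from mult_right_mono[OF this, of "real (M 2)"]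
    show "(\<Sum>i<M 0. \<Sum>j<M 1. \<Sum>k<M 2. \<Sum>t<n. ((1 - \<alpha> * a2) * (a1 * x 0 i t + x 1 j t) - ((1 - \<alpha> * a2) * a1 * mean 0 t + (1 - \<alpha> * a2) * mean 1 t))\<^sup>2)
      \<le> ?M * (real n * (\<kappa> - (1 - \<alpha> * a2)\<^sup>2 - \<alpha>\<^sup>2))"
      unfolding \<kappa>_eq by (simp add: sum_distrib_left mult_ac)
    have "(\<Sum>i<M 0. \<Sum>j<M 1. \<Sum>t<n. (a2 * a1 * x 0 i t - a2 * a1 * mean 0 t)\<^sup>2)
      \<le> real (M 0) * real (M 1) * (real n * ((a2 * a1)\<^sup>2 * P1))"
      \<comment> \<open>The reference for S is conditioned on X2, so X2 carries coefficient 0 and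
        only the power of X1 remains.\<close>
      using sum_centered_power_le[where f="x 0" and g="x 1" and b="a2 * a1" and c=0, OF M(1) M(2) pw(1) pw(2)]
      unfolding mean_def[symmetric] by simp
    from mult_right_mono[OF this, of "real (M 2)"]
    show "(\<Sum>i<M 0. \<Sum>j<M 1. \<Sum>k<M 2. \<Sum>t<n. (a2 * a1 * x 0 i t - a2 * a1 * mean 0 t)\<^sup>2)
      \<le> ?M * (real n * (1 + a2\<^sup>2 * (1 + a1\<^sup>2 * P1) - a2\<^sup>2 - 1))"
      by (simp add: sum_distrib_left mult_ac distrib_left power_mult_distrib)
    have "(\<Sum>j<M 1. \<Sum>k<M 2. \<Sum>t<n. (x 2 k t + a2 * x 1 j t - (a2 * mean 1 t + mean 2 t))\<^sup>2)
      \<le> real (M 1) * real (M 2) * (real n * (a2\<^sup>2 * P2 + P3))"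
      using sum_centered_power_le[where f="x 1" and g="x 2" and b=a2 and c=1, OF M(2) M(3) pw(2) pw(3)]
      unfolding mean_def[symmetric] by (simp add: add.commute)
    from mult_left_mono[OF this, of "real (M 0)"]
    show "(\<Sum>i<M 0. \<Sum>j<M 1. \<Sum>k<M 2. \<Sum>t<n. (x 2 k t + a2 * x 1 j t - (a2 * mean 1 t + mean 2 t))\<^sup>2)
      \<le> ?M * (real n * (1 + a2\<^sup>2 * P2 + P3 - 1))"
      by (simp add: mult_ac)
  qed simp
  let ?q1 = "\<lambda>i. \<integral>w. hit (d 0) i (vec_shift n (x 0 i) w) \<partial>?G"
  let ?q2 = "\<lambda>i j. \<integral>w. hit (d 1) j (vec_shift n (\<lambda>t. a1 * x 0 i t + x 1 j t) w) \<partial>?G"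
  let ?q3 = "\<lambda>j k. \<integral>w. hit (d 2) k (vec_shift n (\<lambda>t. x 2 k t + a2 * x 1 j t) w) \<partial>?G"
  have ih: "integrable ?G (\<lambda>w. hit (d u) m (vec_shift n c w))"
    if "hit (d u) m \<in> borel_measurable (PiM {..<n} (\<lambda>_. borel))" for u m c
  proof (rule C.G.integrable_const_bound[where B=1])
    have "vec_shift n c \<in> measurable ?G (PiM {..<n} (\<lambda>_. borel))" by measurable
    from measurable_compose[OF this that]
    show "(\<lambda>w. hit (d u) m (vec_shift n c w)) \<in> borel_measurable ?G" .
  qed (simp add: hit_def)
  have l3: "ln (real (M 2)) * ?q3 j k - ln 2 \<le> (\<integral>w. ln (r3 k (vec_shift n (\<lambda>t. x 2 k t + a2 * x 1 j t) w)) \<partial>?G)" for j k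
  proof -
    let ?y = "\<lambda>w. vec_shift n (\<lambda>t. x 2 k t + a2 * x 1 j t) w"
    have "ln (real (M 2)) * ?q3 j k - ln 2 = (\<integral>w. ln (real (M 2)) * hit (d 2) k (?y w) - ln 2 \<partial>?G)"
      using ih[OF hm(3)] by (simp add: C.G.prob_space)
    also have "\<dots> \<le> (\<integral>w. ln (r3 k (?y w)) \<partial>?G)"
    proof (intro integral_mono C.integrable_ln_bounded[OF mr3 _ b3])
      fix w show "ln (real (M 2)) * hit (d 2) k (?y w) - ln 2 \<le> ln (r3 k (?y w))"
        using ln_fano_weight[OF hit_bounds, of "real (M 2)" "d 2" k "?y w"] M(3) by (simp add: r3_def mult.commute)
    qed (use ih[OF hm(3)] in auto)
    finally show ?thesis .
  qed
  \<comment> \<open>Averaged over Z2, the degraded output is \<open>x 0 i\<close> plus unit Gaussian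
    noise, so the mean of \<open>p1\<close> equals the true success probability of receiver 1 and
    does not depend on \<open>j\<close>.\<close>
  have q1: "(\<integral>z. p1 i j (vec_shift n (\<lambda>t. a1 * x 0 i t + x 1 j t) z) \<partial>?G) = ?q1 i"
    and ip1: "integrable ?G (\<lambda>z. p1 i j (vec_shift n (\<lambda>t. a1 * x 0 i t + x 1 j t) z))" for i j
  proof -
    let ?h = "\<lambda>q. \<lambda>t\<in>{..<n}. 1 / a1 * fst q t + \<beta> * snd q t"
    let ?v = "\<lambda>z. vec_shift n (\<lambda>t. a1 * x 0 i t + x 1 j t) z"
    have mv: "?v \<in> measurable ?G (PiM {..<n} (\<lambda>_. borel))" by measurable
    show "integrable ?G (\<lambda>z. p1 i j (?v z))"
      using p1 by (intro C.G.integrable_const_bound[where B=1] measurable_compose[OF mv mp1]) auto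
    have eq: "deg j (?v z) z' = vec_shift n (x 0 i) (?h (z, z'))" for z z'
      using a1 by (auto simp: deg_def vec_shift_def fun_eq_iff field_simps)
    have mh: "?h \<in> measurable ?P ?G"
      unfolding measurable_cong_sets[OF refl sets_gauss_vec] by measurable
    have m0: "(\<lambda>w. hit (d 0) i (vec_shift n (x 0 i) w)) \<in> borel_measurable ?G"
      using ih[OF hm(1)] by (rule borel_measurable_integrable)
    have int: "integrable ?P (\<lambda>q. hit (d 0) i (vec_shift n (x 0 i) (?h q)))"
    proof (rule PP.integrable_const_bound[where B=1])
      show "(\<lambda>q. hit (d 0) i (vec_shift n (x 0 i) (?h q))) \<in> borel_measurable ?P"
        by (rule measurable_compose[OF mh m0])
    qed (simp add: hit_def)
    have "(\<integral>z. p1 i j (?v z) \<partial>?G) = (\<integral>z. \<integral>z'. hit (d 0) i (vec_shift n (x 0 i) (?h (z, z'))) \<partial>?G \<partial>?G)"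
      unfolding p1_def eq ..
    also have "\<dots> = (\<integral>q. hit (d 0) i (vec_shift n (x 0 i) (?h q)) \<partial>?P)"
      by (rule PP.integral_fst'[OF int])
    also have "\<dots> = (\<integral>w. hit (d 0) i (vec_shift n (x 0 i) w) \<partial>distr ?P ?G ?h)"
      by (rule integral_distr[OF mh m0, symmetric])
    also have "\<dots> = ?q1 i"
      using a1 \<beta> by (subst distr_gauss_vec_combination) auto
    finally show "(\<integral>z. p1 i j (?v z) \<partial>?G) = ?q1 i" .
  qed
  have l12: "ln (real (M 0)) * ?q1 i + ln (real (M 1)) * ?q2 i j - 2 * ln 2
      \<le> (\<integral>z. ln (r12 i j (vec_shift n (\<lambda>t. a1 * x 0 i t + x 1 j t) z)) \<partial>?G)" for i j
  proof -
    let ?v = "\<lambda>z. vec_shift n (\<lambda>t. a1 * x 0 i t + x 1 j t) z"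
    have "ln (real (M 0)) * ?q1 i + ln (real (M 1)) * ?q2 i j - 2 * ln 2
      = (\<integral>z. ln (real (M 0)) * p1 i j (?v z) + ln (real (M 1)) * hit (d 1) j (?v z) - 2 * ln 2 \<partial>?G)"
      unfolding q1[of i j, symmetric] using ih[OF hm(2)] ip1[of i j] by (simp add: C.G.prob_space)
    also have "\<dots> \<le> (\<integral>z. ln (r12 i j (?v z)) \<partial>?G)"
    proof (intro integral_mono C.integrable_ln_bounded[OF mr12 _ b12])
      fix z
      have "ln (r12 i j (?v z)) = ln (r1 i j (?v z)) + ln (r2 j (?v z))"
        unfolding r12_def using b1(1)[of i j "?v z"] b2(1)[of j "?v z"] by (intro ln_mult_pos) auto
      then show "ln (real (M 0)) * p1 i j (?v z) + ln (real (M 1)) * hit (d 1) j (?v z) - 2 * ln 2 \<le> ln (r12 i j (?v z))"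
        using ln_fano_weight[OF p1, of "real (M 0)" i j "?v z"] ln_fano_weight[OF hit_bounds, of "real (M 1)" "d 1" j "?v z"] M
        by (simp add: r1_def r2_def mult.commute)
    qed (use ih[OF hm(2)] ip1[of i j] in auto)
    finally show ?thesis .
  qed
  have "?M * ((1 - \<epsilon>) * (ln (real (M 0)) + ln (real (M 1)) + ln (real (M 2))) - 3 * ln 2)
    = ln (real (M 0)) * ((1 - \<epsilon>) * ?M) + ln (real (M 1)) * ((1 - \<epsilon>) * ?M) + ln (real (M 2)) * ((1 - \<epsilon>) * ?M) - 3 * ln 2 * ?M"
    by (simp add: algebra_simps)
  also have "\<dots> \<le> ln (real (M 0)) * (\<Sum>i<M 0. \<Sum>j<M 1. \<Sum>k<M 2. ?q1 i) + ln (real (M 1)) * (\<Sum>i<M 0. \<Sum>j<M 1. \<Sum>k<M 2. ?q2 i j)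
      + ln (real (M 2)) * (\<Sum>i<M 0. \<Sum>j<M 1. \<Sum>k<M 2. ?q3 j k) - 3 * ln 2 * ?M"
    using M by (intro diff_right_mono add_mono mult_left_mono sum_hit_ge[OF code err]) auto
  also have "\<dots> = (\<Sum>i<M 0. \<Sum>j<M 1. \<Sum>k<M 2. (ln (real (M 0)) * ?q1 i + ln (real (M 1)) * ?q2 i j - 2 * ln 2)
      + (ln (real (M 2)) * ?q3 j k - ln 2))"
    by (simp add: sum.distrib sum_subtractf sum_distrib_left algebra_simps)
  also have "\<dots> \<le> (\<Sum>i<M 0. \<Sum>j<M 1. \<Sum>k<M 2.
        (\<integral>z. ln (r12 i j (vec_shift n (\<lambda>t. a1 * x 0 i t + x 1 j t) z)) \<partial>?G)
      + (\<integral>w. ln (r3 k (vec_shift n (\<lambda>t. x 2 k t + a2 * x 1 j t) w)) \<partial>?G))"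
    by (intro sum_mono add_mono l12 l3)
  also note upper
  finally have "?M * ((1 - \<epsilon>) * (ln (real (M 0)) + ln (real (M 1)) + ln (real (M 2))) - 3 * ln 2)
      \<le> ?M * (real n / 2 * (ln \<kappa> + ln (1 + a2\<^sup>2 * (1 + a1\<^sup>2 * P1)) + ln (1 + a2\<^sup>2 * P2 + P3)))" .
  moreover have "?M > 0" using M by simp
  ultimately show ?thesis
    unfolding \<kappa>_def D_def by (simp only: mult_le_cancel_left_pos)
qed

section \<open>Long blocks, vanishing error and the half bit\<close>

text \<open>At a fixed error level the block length grows first, which removes the Fano constants
  after division by \<open>n\<close>; only then does the error level tend to 0.\<close>

lemma achievable_sum_rate_le:
  assumes ach: "achievable a1 a2 P1 P2 P3 R"
    and a1: "a1 \<ge> 1" and P: "P1 \<ge> 0" "P2 \<ge> 0" "P3 \<ge> 0"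
    and a2: "a2\<^sup>2 * (1 + a1\<^sup>2 * P1) \<le> 1"
  shows "fst R + fst (snd R) + snd (snd R) \<le> Cfun (a1\<^sup>2 * P1 + P2) + Cfun (P3 / (1 + a2\<^sup>2 * P2)) + 0.5"
proof -
  let ?S = "fst R + fst (snd R) + snd (snd R)"
  let ?T = "Cfun (a1\<^sup>2 * P1 + P2) + Cfun (P3 / (1 + a2\<^sup>2 * P2)) + 0.5"
  define p where "p = 1 + a1\<^sup>2 * P1 + P2"
  define K where "K = ln (p / (1 + a2\<^sup>2 * p)) + ln (1 + a2\<^sup>2 * (1 + a1\<^sup>2 * P1)) + ln (1 + a2\<^sup>2 * P2 + P3)"
  have a1P1: "a1\<^sup>2 * P1 \<ge> 0" using P by simp
  have a2P2: "a2\<^sup>2 * P2 \<ge> 0" using P by simp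
  have p_pos: "p > 0" unfolding p_def using P a1P1 by linarith
  have D1: "1 + a2\<^sup>2 * p > 0" using p_pos by (intro add_pos_nonneg) auto
  have D2: "1 + a2\<^sup>2 * P2 > 0" using a2P2 by linarith
  have D3: "1 + a2\<^sup>2 * (1 + a1\<^sup>2 * P1) > 0" using a1P1 by (intro add_pos_nonneg) auto
  have D4: "1 + a2\<^sup>2 * P2 + P3 > 0" using D2 P by linarith
  \<comment> \<open>With A = a2^2 (1 + a1^2 P1) and B = a2^2 P2 this reads (1 + A)(1 + B) \<le> 2 (1
    + A + B), true because A \<le> 1 gives AB \<le> B. The factor 2 becomes the half bit.\<close>
  have "(1 + a2\<^sup>2 * (1 + a1\<^sup>2 * P1)) * (1 + a2\<^sup>2 * P2) \<le> 2 * (1 + a2\<^sup>2 * p)"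
  proof -
    have *: "(1 + A) * (1 + B) \<le> 2 * (1 + (A + B))" if "0 \<le> A" "A \<le> 1" "0 \<le> B" for A B :: real
      using that mult_right_mono[of A 1 B] by (simp add: algebra_simps)
    have "a2\<^sup>2 * p = a2\<^sup>2 * (1 + a1\<^sup>2 * P1) + a2\<^sup>2 * P2"
      unfolding p_def by (simp add: algebra_simps)
    then show ?thesis
      using *[OF _ a2 a2P2] a1P1 by simp
  qed
  then have "ln ((1 + a2\<^sup>2 * (1 + a1\<^sup>2 * P1)) * (1 + a2\<^sup>2 * P2)) \<le> ln (2 * (1 + a2\<^sup>2 * p))"
    using D1 D2 D3 by simp
  then have gap: "ln (1 + a2\<^sup>2 * (1 + a1\<^sup>2 * P1)) + ln (1 + a2\<^sup>2 * P2) \<le> ln 2 + ln (1 + a2\<^sup>2 * p)"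
    by (simp only: ln_mult_pos[OF D3 D2] ln_mult_pos[OF zero_less_numeral D1])
  have "1 + P3 / (1 + a2\<^sup>2 * P2) = (1 + a2\<^sup>2 * P2 + P3) / (1 + a2\<^sup>2 * P2)"
    using D2 by (simp add: field_simps)
  then have "2 * ln 2 * ?T = ln p + (ln (1 + a2\<^sup>2 * P2 + P3) - ln (1 + a2\<^sup>2 * P2)) + ln 2"
    unfolding Cfun_def log_def using D2 D4
    by (simp add: ln_div p_def field_simps)
  moreover have "K = ln p - ln (1 + a2\<^sup>2 * p) + ln (1 + a2\<^sup>2 * (1 + a1\<^sup>2 * P1)) + ln (1 + a2\<^sup>2 * P2 + P3)"
    unfolding K_def using p_pos D1 by (simp add: ln_div)
  ultimately have K: "K \<le> 2 * ln 2 * ?T"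
    using gap by linarith
  have divide_out: "X - 3 * inverse m \<le> T" if "X * m \<le> 3 + T * m" "m > 0" for X T m :: real
    using that by (simp add: field_simps)
  \<comment> \<open>The restriction \<open>\<epsilon> < 1\<close> keeps
    \<open>1 - \<epsilon>\<close> positive, so the rates may be replaced by the logarithms of the
    message counts.\<close>
  have main: "(1 - \<epsilon>) * ?S \<le> ?T" if \<epsilon>: "0 < \<epsilon>" "\<epsilon> < 1" for \<epsilon>
  proof -
    from ach \<epsilon>(1) obtain N where N: "\<And>n. n \<ge> N \<Longrightarrow> n \<ge> 1 \<and> (\<exists>M x d. is_code P1 P2 P3 n M x d \<and>
         (\<forall>i<3. real (M i) \<ge> 2 powr (real n * [fst R, fst (snd R), snd (snd R)] ! i)) \<and>
         err_prob a1 a2 n M x d \<le> \<epsilon>)"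
      unfolding achievable_def Let_def by blast
    have "(1 - \<epsilon>) * ?S - 3 * inverse (real n) \<le> ?T" if n: "n \<ge> N" for n
    proof -
      from N[OF n] obtain M x d where n1: "n \<ge> 1" and code: "is_code P1 P2 P3 n M x d"
        and rate: "\<forall>i<3. real (M i) \<ge> 2 powr (real n * [fst R, fst (snd R), snd (snd R)] ! i)"
        and err: "err_prob a1 a2 n M x d \<le> \<epsilon>" by blast
      have M: "2 powr (real n * fst R) \<le> real (M 0)" "2 powr (real n * fst (snd R)) \<le> real (M 1)"
        "2 powr (real n * snd (snd R)) \<le> real (M 2)"
        using rate[rule_format, of 0] rate[rule_format, of 1] rate[rule_format, of 2] by auto
      have lnM: "real n * r * ln 2 \<le> ln (real m)" if "2 powr (real n * r) \<le> real m" for r m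
      proof -
        have "ln (2 powr (real n * r)) \<le> ln (real m)"
          using that by (intro ln_mono) (auto intro: less_le_trans[of _ "2 powr (real n * r)"])
        then show ?thesis by (simp add: ln_powr)
      qed
      have "real n * ?S * ln 2 \<le> ln (real (M 0)) + ln (real (M 1)) + ln (real (M 2))"
        using lnM[OF M(1)] lnM[OF M(2)] lnM[OF M(3)] by (simp add: algebra_simps)
      then have "(1 - \<epsilon>) * (real n * ?S * ln 2) \<le> (1 - \<epsilon>) * (ln (real (M 0)) + ln (real (M 1)) + ln (real (M 2)))"
        using \<epsilon> by (intro mult_left_mono) auto
      also have "\<dots> \<le> 3 * ln 2 + real n / 2 * K"
        using code_bound[OF code err a1 P p_def] unfolding K_def by linarith
      also have "\<dots> \<le> 3 * ln 2 + real n / 2 * (2 * ln 2 * ?T)"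
        using K by (intro add_left_mono mult_left_mono) auto
      finally have "((1 - \<epsilon>) * ?S * real n) * ln 2 \<le> (3 + ?T * real n) * ln 2"
        by (simp add: algebra_simps)
      then have "(1 - \<epsilon>) * ?S * real n \<le> 3 + ?T * real n"
        by (simp only: mult_le_cancel_right_pos ln_gt_zero_iff one_less_numeral_iff semiring_norm)
      then show ?thesis using n1 by (intro divide_out) auto
    qed
    then have "eventually (\<lambda>n. (1 - \<epsilon>) * ?S - 3 * inverse (real n) \<le> ?T) sequentially"
      unfolding eventually_sequentially by blast
    moreover have "(\<lambda>n. (1 - \<epsilon>) * ?S - 3 * inverse (real n)) \<longlonglongrightarrow> (1 - \<epsilon>) * ?S - 3 * 0"
      by (intro tendsto_intros LIMSEQ_inverse_real_of_nat lim_inverse_n)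
    ultimately show ?thesis
      using tendsto_upperbound[of "\<lambda>n. (1 - \<epsilon>) * ?S - 3 * inverse (real n)" _ sequentially ?T] by simp
  qed
  have "((\<lambda>\<epsilon>. (1 - \<epsilon>) * ?S) \<longlongrightarrow> (1 - 0) * ?S) (at_right 0)"
    by (intro tendsto_intros)
  moreover have "eventually (\<lambda>\<epsilon>. (1 - \<epsilon>) * ?S \<le> ?T) (at_right 0)"
    using main unfolding eventually_at_right[OF zero_less_one] by (intro exI[of _ 1]) auto
  ultimately show ?thesis
    using tendsto_upperbound[of "\<lambda>\<epsilon>. (1 - \<epsilon>) * ?S" _ "at_right 0" ?T] by simp
qed

theorem theorem4:
  fixes a1 a2 P1 P2 P3 :: real
  assumes "a1 \<ge> 0" "a2 \<ge> 0" "P1 > 0" "P2 > 0" "P3 > 0"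
    and "1 \<le> a1" "a1 < sqrt (1 + P2)"
    and "a2 \<le> sqrt (1 / (1 + a1\<^sup>2 * P1))"
  shows "sum_capacity a1 a2 P1 P2 P3
           \<le> ereal (Cfun (a1\<^sup>2 * P1 + P2) + Cfun (P3 / (1 + a2\<^sup>2 * P2)) + 0.5)"
proof -
  have s: "1 + a1\<^sup>2 * P1 > 0"
    using assms(3) by (intro add_pos_nonneg) auto
  have "a2\<^sup>2 \<le> (sqrt (1 / (1 + a1\<^sup>2 * P1)))\<^sup>2"
    using assms(2,8) by (intro power_mono)
  then have "a2\<^sup>2 \<le> 1 / (1 + a1\<^sup>2 * P1)"
    using s by simp
  then have "a2\<^sup>2 * (1 + a1\<^sup>2 * P1) \<le> 1"
    using s by (simp add: pos_le_divide_eq)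
  then show ?thesis
    unfolding sum_capacity_def using assms
    by (intro SUP_least) (auto intro!: achievable_sum_rate_le[simplified])
qed

end
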